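(* Let $a:\mathbb{R}\to\mathbb{R}$ be a measurable function, $x\in\mathbb{R}$, and let $Z$ be a real-valued Lévy process. Assume that there exists a unique weak solution of the stochastic equation $$\xi(t)=x+\int_0^t a(\xi(s))\,ds+Z(t),\qquad t\ge 0.$$ Then this solution is a strong solution.
   Context: A Lévy process on a filtered probability space $(\Omega,\mathcal{F},(\mathcal{F}_t),P)$ is understood as a càdlàg $(\mathcal{F}_t)$-adapted process with $Z(0)=0$, stationary increments, and $Z(t+s)-Z(t)$ independent of $\mathcal{F}_t$ for all $s,t\ge 0$. A solution of the equation on such a space is an $(\mathcal{F}_t)$-adapted process $\xi$ such that almost surely $\int_0^T|a(\xi(s))|\,ds<\infty$ for all $T>0$ and the equation holds for all $t\ge0$. A weak solution consists of some filtered probability space carrying a Lévy process of the given law together with a solution $\xi$ on it; the weak solution is unique if any two weak solutions (possibly on different filtered probability spaces) with the same initial value $x$ have processes $\xi$ with the same distribution. A solution is strong if it is adapted to the completed filtration generated by the driving process $Z$. *)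

theory Defs
  imports "HOL-Probability.Probability"
begin

text \<open>
  Processes and filtrations have time set \<open>[0, \<infinity>)\<close>. They are functions of type
  \<open>real \<Rightarrow> _\<close> whose values at negative times are never used.
\<close>

locale filtered_prob_space = prob_space M
  for M :: "'w measure" and F :: "real \<Rightarrow> 'w measure" +
  assumes subalgebra_F: "\<And>t. 0 \<le> t \<Longrightarrow> subalgebra M (F t)"
    and F_mono: "\<And>s t. 0 \<le> s \<Longrightarrow> s \<le> t \<Longrightarrow> sets (F s) \<subseteq> sets (F t)"

definition adapted :: "(real \<Rightarrow> 'w measure) \<Rightarrow> (real \<Rightarrow> 'w \<Rightarrow> real) \<Rightarrow> bool" where
  "adapted F X \<longleftrightarrow> (\<forall>t\<ge>0. X t \<in> borel_measurable (F t))"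

definition cadlag :: "(real \<Rightarrow> real) \<Rightarrow> bool" where
  "cadlag f \<longleftrightarrow> (\<forall>t\<ge>0. continuous (at_right t) f) \<and> (\<forall>t>0. \<exists>l. (f \<longlongrightarrow> l) (at_left t))"

locale levy_process = filtered_prob_space M F
  for M :: "'w measure" and F :: "real \<Rightarrow> 'w measure" and Z :: "real \<Rightarrow> 'w \<Rightarrow> real" +
  assumes adapted_Z: "adapted F Z"
    and cadlag_Z: "\<And>\<omega>. \<omega> \<in> space M \<Longrightarrow> cadlag (\<lambda>t. Z t \<omega>)"
    and Z_zero: "\<And>\<omega>. \<omega> \<in> space M \<Longrightarrow> Z 0 \<omega> = 0"
    and stationary_increments: "\<And>s t. 0 \<le> s \<Longrightarrow> 0 \<le> t \<Longrightarrow>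
      distr M borel (\<lambda>\<omega>. Z (t + s) \<omega> - Z t \<omega>) = distr M borel (\<lambda>\<omega>. Z s \<omega> - Z 0 \<omega>)"
    and independent_increments: "\<And>s t. 0 \<le> s \<Longrightarrow> 0 \<le> t \<Longrightarrow>
      indep_set {(\<lambda>\<omega>. Z (t + s) \<omega> - Z t \<omega>) -` A \<inter> space M | A. A \<in> sets (borel :: real measure)}
        (sets (F t))"

definition process_law :: "'w measure \<Rightarrow> (real \<Rightarrow> 'w \<Rightarrow> real) \<Rightarrow> (real \<Rightarrow> real) measure" where
  "process_law M X = distr M (Pi\<^sub>M {0..} (\<lambda>_. borel)) (\<lambda>\<omega>. \<lambda>t\<in>{0..}. X t \<omega>)"

definition sde_solution ::
  "(real \<Rightarrow> real) \<Rightarrow> real \<Rightarrow> 'w measure \<Rightarrow> (real \<Rightarrow> 'w measure) \<Rightarrow> (real \<Rightarrow> 'w \<Rightarrow> real)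
    \<Rightarrow> (real \<Rightarrow> 'w \<Rightarrow> real) \<Rightarrow> bool" where
  "sde_solution a x M F Z \<xi> \<longleftrightarrow> adapted F \<xi> \<and>
    (AE \<omega> in M. (\<forall>T>0. set_integrable lborel {0..T} (\<lambda>s. a (\<xi> s \<omega>))) \<and>
      (\<forall>t\<ge>0. \<xi> t \<omega> = x + (LINT s:{0..t}|lborel. a (\<xi> s \<omega>)) + Z t \<omega>))"

text \<open>The parameter \<open>L\<close> is the prescribed law of the driving process.\<close>

definition weak_solution ::
  "(real \<Rightarrow> real) \<Rightarrow> real \<Rightarrow> (real \<Rightarrow> real) measure \<Rightarrow> 'w measure \<Rightarrow> (real \<Rightarrow> 'w measure)
    \<Rightarrow> (real \<Rightarrow> 'w \<Rightarrow> real) \<Rightarrow> (real \<Rightarrow> 'w \<Rightarrow> real) \<Rightarrow> bool" where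
  "weak_solution a x L M F Z \<xi> \<longleftrightarrow>
    levy_process M F Z \<and> process_law M Z = L \<and> sde_solution a x M F Z \<xi>"

text \<open>
  HOL cannot quantify over the type of sample points inside a formula. Existence and uniqueness
  therefore range over all filtered probability spaces whose sample points form an arbitrary subset
  of the type of pairs of paths. This loses nothing: for a weak solution on a space of any other
  type, delete a null set outside of which the equation holds and map each remaining \<open>\<omega>\<close> to its
  pair of paths of \<open>\<xi>\<close> and \<open>Z\<close>. On the image, with the image measure and the filtration generated
  by the coordinates, the coordinate processes form a weak solution with the same joint law.
\<close>

type_synonym path_pair = "(real \<Rightarrow> real) \<times> (real \<Rightarrow> real)"

definition weak_solution_exists ::
  "(real \<Rightarrow> real) \<Rightarrow> real \<Rightarrow> (real \<Rightarrow> real) measure \<Rightarrow> bool" where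
  "weak_solution_exists a x L \<longleftrightarrow>
    (\<exists>(M :: path_pair measure) F Z \<xi>. weak_solution a x L M F Z \<xi>)"

definition weak_solution_unique ::
  "(real \<Rightarrow> real) \<Rightarrow> real \<Rightarrow> (real \<Rightarrow> real) measure \<Rightarrow> bool" where
  "weak_solution_unique a x L \<longleftrightarrow>
    (\<forall>(M :: path_pair measure) F Z \<xi> (M' :: path_pair measure) F' Z' \<xi>'.
      weak_solution a x L M F Z \<xi> \<longrightarrow> weak_solution a x L M' F' Z' \<xi>' \<longrightarrow>
      process_law M \<xi> = process_law M' \<xi>')"

text \<open>
  The completion adds all subsets of null sets of the underlying space, not only of null sets of
  the sigma-algebra generated by \<open>Z\<close>: a solution satisfies the equation only outside a null set of
  the former kind.
\<close>

definition completed_natural_filtration ::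
  "'w measure \<Rightarrow> (real \<Rightarrow> 'w \<Rightarrow> real) \<Rightarrow> real \<Rightarrow> 'w measure" where
  "completed_natural_filtration M Z t = sigma (space M)
    ({Z s -` A \<inter> space M | s A. 0 \<le> s \<and> s \<le> t \<and> A \<in> sets borel} \<union> null_sets (completion M))"

definition strong_solution ::
  "(real \<Rightarrow> real) \<Rightarrow> real \<Rightarrow> 'w measure \<Rightarrow> (real \<Rightarrow> 'w measure) \<Rightarrow> (real \<Rightarrow> 'w \<Rightarrow> real)
    \<Rightarrow> (real \<Rightarrow> 'w \<Rightarrow> real) \<Rightarrow> bool" where
  "strong_solution a x M F Z \<xi> \<longleftrightarrow>
    sde_solution a x M F Z \<xi> \<and> adapted (completed_natural_filtration M Z) \<xi>"

end

theory Submission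
  imports Defs
begin

text \<open>
  The proof combines pathwise uniqueness with the argument of Yamada and Watanabe.

  Pathwise uniqueness follows from weak uniqueness by an ordering argument. Let \<open>\<xi>\<close> and \<open>\<xi>'\<close> solve the
  equation on one space with the same \<open>Z\<close>. The noise cancels in \<open>\<xi>' - \<xi>\<close>, which is absolutely
  continuous with density \<open>a(\<xi>') - a(\<xi>)\<close>. This density vanishes where \<open>\<xi> = \<xi>'\<close>, and it follows
  that \<open>max \<xi> \<xi>'\<close> is again a solution (\<open>solves_path_max\<close>). All three processes have the same law, and
  ordered variables with the same law are almost surely equal (\<open>pathwise_uniqueness\<close>).

  For a given solution \<open>\<xi>\<close>, one then builds on an extension of the space a second solution \<open>\<xi>'\<close> with the
  same \<open>Z\<close>, which has jointly with \<open>Z\<close> the law of \<open>\<xi>\<close> and is conditionally independent of \<open>\<xi>\<close> given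
  \<open>Z\<close>. By pathwise uniqueness \<open>\<xi>' = \<xi>\<close>, and a variable that equals a conditionally independent copy
  of itself is, up to null sets, a function of what is conditioned on. That \<open>Z\<close> is still a Levy process
  in the enlarged filtration, and that \<open>\<xi> t\<close> depends on \<open>Z\<close> only up to time \<open>t\<close>, both rest on the fact
  that an event known at time \<open>t\<close> has the same conditional probability given \<open>Z\<close> as given \<open>Z\<close> up to time
  \<open>t\<close> (\<open>cond_prob_past\<close>).

  The copy needs no regular conditional distributions on path space. The drift \<open>\<xi> - x - Z\<close> is continuous,
  hence determined by countably many values; these are coded by one real variable
  (\<open>real_code_of_sequence\<close>), and a real variable is copied by applying the quantile transform of its
  conditional distribution function to an independent uniform variable (\<open>conditional_copy\<close>).
\<close>

section \<open>The maximum of two solutions along one path\<close>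

lemma set_integral_diff_interval:
  fixes g :: "real \<Rightarrow> real"
  assumes g: "set_integrable lborel {0..T} g" and uv: "0 \<le> u" "u \<le> v" "v \<le> T"
  shows "(LINT s:{0..v}|lborel. g s) - (LINT s:{0..u}|lborel. g s) = (LINT s:{u..v}|lborel. g s)"
proof -
  have i: "set_integrable lborel A g" if "A \<subseteq> {0..T}" "A \<in> sets borel" for A
    using set_integrable_subset[OF g] that by auto
  have "(LINT s:{0..v}|lborel. g s) = integral {0..v} g"
    "(LINT s:{0..u}|lborel. g s) = integral {0..u} g"
    "(LINT s:{u..v}|lborel. g s) = integral {u..v} g"
    using uv by (auto intro!: set_borel_integral_eq_integral(2) i)
  moreover have "integral {0..u} g + integral {u..v} g = integral {0..v} g"
    using uv by (intro Henstock_Kurzweil_Integration.integral_combine set_borel_integral_eq_integral(1) i) auto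
  ultimately show ?thesis by simp
qed

lemma continuous_on_set_integral:
  fixes g :: "real \<Rightarrow> real"
  assumes g: "set_integrable lborel {0..T} g"
  shows "continuous_on {0..T} (\<lambda>t. LINT s:{0..t}|lborel. g s)"
proof -
  have "continuous_on {0..T} (\<lambda>t. integral {0..t} g)"
    by (intro indefinite_integral_continuous_1 set_borel_integral_eq_integral(1) g)
  moreover have "(LINT s:{0..t}|lborel. g s) = integral {0..t} g" if "t \<in> {0..T}" for t
    using that by (intro set_borel_integral_eq_integral(2) set_integrable_subset[OF g]) auto
  ultimately show ?thesis using continuous_on_eq by (metis (no_types, lifting))
qed

text \<open>
  A chain rule for the positive part of an absolutely continuous function \<open>d\<close> with density
  \<open>g\<close>, in the case that \<open>g\<close> vanishes on the zero set of \<open>d\<close>. The difference \<open>h\<close> of the two sides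
  is constant on each interval without zeros of \<open>d\<close>, and on any interval it changes by at most
  twice the integral of \<open>\<bar>g\<bar>\<close>. Cut \<open>[0, T]\<close> into pieces of length \<open>T / (n + 1)\<close>: only pieces close
  to the zero set contribute, and as \<open>n\<close> grows their contribution tends to the integral of
  \<open>\<bar>g\<bar>\<close> over the zero set, which is \<open>0\<close>.
\<close>

lemma positive_part_of_integral:
  fixes g :: "real \<Rightarrow> real"
  defines "d \<equiv> \<lambda>t. LINT s:{0..t}|lborel. g s"
  assumes T: "0 \<le> T" and g: "set_integrable lborel {0..T} g"
    and zero: "\<And>s. s \<in> {0..T} \<Longrightarrow> d s = 0 \<Longrightarrow> g s = 0"
  shows "set_integrable lborel {0..T} (\<lambda>s. if 0 < d s then g s else 0)"
    and "max 0 (d T) = (LINT s:{0..T}|lborel. if 0 < d s then g s else 0)"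
proof -
  define p where "p = (\<lambda>s. if 0 < d s then g s else 0)"
  define q where "q = (\<lambda>t. LINT s:{0..t}|lborel. p s)"
  define h where "h = (\<lambda>t. max 0 (d t) - q t)"
  define K where "K = {z\<in>{0..T}. d z = 0}"
  define w where "w = (\<lambda>n s. if infdist s K \<le> T / real (Suc n) then \<bar>g s\<bar> else 0)"
  have cont: "continuous_on {0..T} d"
    unfolding d_def by (rule continuous_on_set_integral[OF g])
  have ind: "(\<lambda>s. indicator {0..T} s * d s) \<in> borel_measurable borel"
    using borel_measurable_continuous_on_indicator[OF _ cont] by (simp add: mult.commute)
  have gm: "(\<lambda>s. indicator {0..T} s * g s) \<in> borel_measurable borel"
    using g by (auto simp: set_integrable_def dest: borel_measurable_integrable)
  have gi: "set_integrable lborel {0..T} (\<lambda>s. \<bar>g s\<bar>)"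
    using set_integrable_abs[OF g] .
  have pi: "set_integrable lborel {0..T} p"
  proof (rule set_integrable_bound[OF g])
    have "(\<lambda>s. if 0 < indicator {0..T} s * d s then indicator {0..T} s * g s else 0) \<in> borel_measurable borel"
      using ind gm by measurable
    moreover have "(\<lambda>s. if 0 < indicator {0..T} s * d s then indicator {0..T} s * g s else 0)
       = (\<lambda>s. indicator {0..T} s * p s)" by (auto simp: p_def indicator_def)
    ultimately show "set_borel_measurable lborel {0..T} p"
      by (simp add: set_borel_measurable_def)
  qed (auto simp: p_def)
  then show "set_integrable lborel {0..T} (\<lambda>s. if 0 < d s then g s else 0)"
    by (simp add: p_def)
  have [measurable]: "(\<lambda>s. infdist s K) \<in> borel_measurable borel"
    by (intro borel_measurable_continuous_onI continuous_on_infdist continuous_on_id)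
  have wi: "set_integrable lborel {0..T} (w n)" for n
  proof (rule set_integrable_bound[OF g])
    have "(\<lambda>s. if infdist s K \<le> T / real (Suc n) then \<bar>indicator {0..T} s * g s\<bar> else 0) \<in> borel_measurable borel"
      using gm by measurable
    moreover have "(\<lambda>s. if infdist s K \<le> T / real (Suc n) then \<bar>indicator {0..T} s * g s\<bar> else 0)
       = (\<lambda>s. indicator {0..T} s * w n s)" by (auto simp: w_def indicator_def)
    ultimately show "set_borel_measurable lborel {0..T} (w n)"
      by (simp add: set_borel_measurable_def)
  qed (auto simp: w_def)
  have "(LINT s:{0..0}|lborel. f s) = 0" for f :: "real \<Rightarrow> real"
  proof -
    have "AE s in lborel. indicator {0..0} s *\<^sub>R f s = 0"
      using AE_lborel_singleton[of "0::real"] by eventually_elim auto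
    then show ?thesis unfolding set_lebesgue_integral_def by (rule integral_eq_zero_AE)
  qed
  then have d0: "d 0 = 0" "q 0 = 0" by (simp_all add: d_def q_def del: atLeastAtMost_singleton)
  have sub: "set_integrable lborel {u..v} f" if "set_integrable lborel {0..T} f" "0 \<le> u" "v \<le> T"
    for f :: "real \<Rightarrow> real" and u v
    using that by (intro set_integrable_subset[OF that(1)]) auto
  have dd: "d v - d u = (LINT s:{u..v}|lborel. g s)" "q v - q u = (LINT s:{u..v}|lborel. p s)"
    if "0 \<le> u" "u \<le> v" "v \<le> T" for u v
    using set_integral_diff_interval[OF g that] set_integral_diff_interval[OF pi that]
    by (simp_all add: d_def q_def)
  \<comment> \<open>By the intermediate value theorem, d has constant sign on an interval without zeros.\<close>
  have far: "h v = h u" if uv: "0 \<le> u" "u \<le> v" "v \<le> T" and nz: "\<And>z. z \<in> {u..v} \<Longrightarrow> d z \<noteq> 0" for u v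
  proof -
    have c: "continuous_on {u..v} d" using cont uv by (auto intro: continuous_on_subset)
    have conn: "connected (d ` {u..v})" by (intro connected_continuous_image c connected_Icc)
    have sgn: "(\<forall>z\<in>{u..v}. 0 < d z) \<or> (\<forall>z\<in>{u..v}. d z < 0)"
    proof (rule ccontr)
      assume "\<not> ?thesis"
      then obtain y z where yz: "y \<in> {u..v}" "z \<in> {u..v}" "d y \<le> 0" "0 \<le> d z" by force
      then have "0 \<in> d ` {u..v}"
        using conn unfolding connected_iff_interval by (meson imageI)
      then show False using nz by auto
    qed
    then show ?thesis
    proof
      assume pos: "\<forall>z\<in>{u..v}. 0 < d z"
      then have "(LINT s:{u..v}|lborel. p s) = (LINT s:{u..v}|lborel. g s)"
        by (intro set_lebesgue_integral_cong) (auto simp: p_def)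
      moreover have "0 < d u" "0 < d v" using pos uv by auto
      ultimately show ?thesis using dd[OF uv] by (simp add: h_def)
    next
      assume neg: "\<forall>z\<in>{u..v}. d z < 0"
      then have "(LINT s:{u..v}|lborel. p s) = (LINT s:{u..v}|lborel. 0)"
        by (intro set_lebesgue_integral_cong) (auto simp: p_def dest: order.asym)
      moreover have "d u < 0" "d v < 0" using neg uv by auto
      ultimately show ?thesis using dd[OF uv] by (simp add: h_def set_lebesgue_integral_def)
    qed
  qed
  have near: "\<bar>h v - h u\<bar> \<le> 2 * (LINT s:{u..v}|lborel. \<bar>g s\<bar>)"
    if uv: "0 \<le> u" "u \<le> v" "v \<le> T" for u v
  proof -
    have "\<bar>LINT s:{u..v}|lborel. g s\<bar> \<le> (LINT s:{u..v}|lborel. \<bar>g s\<bar>)"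
      using set_integral_norm_bound[OF sub[OF g uv(1,3)]] by simp
    moreover have "\<bar>LINT s:{u..v}|lborel. p s\<bar> \<le> (LINT s:{u..v}|lborel. \<bar>p s\<bar>)"
      using set_integral_norm_bound[OF sub[OF pi uv(1,3)]] by simp
    moreover have "(LINT s:{u..v}|lborel. \<bar>p s\<bar>) \<le> (LINT s:{u..v}|lborel. \<bar>g s\<bar>)"
      by (intro set_integral_mono set_integrable_abs sub[OF pi uv(1,3)] sub[OF g uv(1,3)])
        (auto simp: p_def)
    ultimately show ?thesis
      using dd[OF uv] by (auto simp: h_def max_def)
  qed
  \<comment> \<open>A piece of the partition that contains a zero of d lies within distance T / (n + 1) of the zero set.\<close>
  have bound: "\<bar>h T\<bar> \<le> 2 * (LINT s:{0..T}|lborel. w n s)" for n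
  proof -
    define D where "D = T / real (Suc n)"
    define t where "t = (\<lambda>i. D * real i)"
    have D: "0 \<le> D" "D * real (Suc n) = T" using T by (simp_all add: D_def)
    have t: "0 \<le> t i" "t i \<le> t (Suc i)" "t (Suc i) - t i = D" for i
      using D(1) by (simp_all add: t_def algebra_simps)
    have tT: "t i \<le> T" if "i \<le> Suc n" for i
      using mult_left_mono[of "real i" "real (Suc n)" D] that D unfolding t_def by simp
    have step: "\<bar>h (t (Suc i)) - h (t i)\<bar> \<le> 2 * (LINT s:{t i..t (Suc i)}|lborel. w n s)"
      if i: "i < Suc n" for i
    proof (cases "\<exists>z\<in>{t i..t (Suc i)}. d z = 0")
      case True
      then obtain z where z: "z \<in> {t i..t (Suc i)}" "d z = 0" by auto
      have zK: "z \<in> K" using z t(1)[of i] tT[of "Suc i"] i by (auto simp: K_def)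
      have "(LINT s:{t i..t (Suc i)}|lborel. \<bar>g s\<bar>) = (LINT s:{t i..t (Suc i)}|lborel. w n s)"
      proof (intro set_lebesgue_integral_cong ballI allI impI)
        fix s assume s: "s \<in> {t i..t (Suc i)}"
        have "infdist s K \<le> dist s z" by (rule infdist_le[OF zK])
        also have "\<dots> \<le> T / real (Suc n)"
          unfolding D_def[symmetric] dist_real_def using s z t(3)[of i] by auto
        finally show "\<bar>g s\<bar> = w n s" by (simp add: w_def)
      qed auto
      then show ?thesis using near[OF t(1,2) tT[of "Suc i"]] i by simp
    next
      case False
      then have "h (t (Suc i)) = h (t i)" using i by (intro far t tT) auto
      moreover have "0 \<le> (LINT s:{t i..t (Suc i)}|lborel. w n s)"
        by (auto simp: set_lebesgue_integral_def w_def intro!: integral_nonneg)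
      ultimately show ?thesis by simp
    qed
    have "\<bar>h (t i)\<bar> \<le> 2 * (LINT s:{0..t i}|lborel. w n s)" if "i \<le> Suc n" for i
      using that
    proof (induction i)
      case 0
      show ?case using d0 by (auto simp: t_def h_def set_lebesgue_integral_def w_def intro!: integral_nonneg)
    next
      case (Suc i)
      have "(LINT s:{0..t (Suc i)}|lborel. w n s) - (LINT s:{0..t i}|lborel. w n s)
         = (LINT s:{t i..t (Suc i)}|lborel. w n s)"
        using Suc.prems by (intro set_integral_diff_interval[OF wi] t tT)
      then show ?case using step[of i] Suc by linarith
    qed
    from this[of "Suc n"] show ?thesis using D(2) by (simp add: t_def)
  qed
  have closedK: "closed K"
  proof -
    have "K = {0..T} \<inter> d -` {0}" by (auto simp: K_def)
    then show ?thesis using continuous_closed_preimage[OF cont] by (metis closed_atLeastAtMost closed_singleton)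
  qed
  have K0: "K \<noteq> {}" using d0 T by (auto simp: K_def)
  have "(\<lambda>n. LINT s|lborel. indicator {0..T} s *\<^sub>R w n s) \<longlonglongrightarrow> (LINT s|(lborel :: real measure). (0::real))"
  proof (rule integral_dominated_convergence)
    show "integrable lborel (\<lambda>s. indicator {0..T} s *\<^sub>R \<bar>g s\<bar>)"
      using gi by (simp add: set_integrable_def)
    show "(\<lambda>s. indicator {0..T} s *\<^sub>R w n s) \<in> borel_measurable lborel" for n
      using wi[of n] by (auto simp: set_integrable_def dest: borel_measurable_integrable)
    show "AE s in lborel. norm (indicator {0..T} s *\<^sub>R w n s) \<le> indicator {0..T} s *\<^sub>R \<bar>g s\<bar>" for n
      by (auto simp: w_def indicator_def)
    show "AE s in lborel. (\<lambda>n. indicator {0..T} s *\<^sub>R w n s) \<longlonglongrightarrow> 0"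
    proof (rule AE_I2)
      fix s :: real
      show "(\<lambda>n. indicator {0..T} s *\<^sub>R w n s) \<longlonglongrightarrow> 0"
      proof (cases "s \<in> {0..T} \<and> s \<notin> K")
        case True
        then have "0 < infdist s K"
          using infdist_nonneg[of s K] in_closed_iff_infdist_zero[OF closedK K0, of s] by (auto simp: less_le)
        moreover have "(\<lambda>n. T / real (Suc n)) \<longlonglongrightarrow> 0"
          by (rule LIMSEQ_Suc, rule lim_const_over_n)
        ultimately have "\<forall>\<^sub>F n in sequentially. T / real (Suc n) < infdist s K"
          by (rule order_tendstoD(2)[rotated])
        then have "\<forall>\<^sub>F n in sequentially. indicator {0..T} s *\<^sub>R w n s = 0"
          by eventually_elim (auto simp: w_def)
        then show ?thesis by (rule tendsto_eventually)
      next
        case False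
        then have "(\<lambda>n. indicator {0..T} s *\<^sub>R w n s) = (\<lambda>n. 0)"
          using zero[of s] by (auto simp: w_def K_def indicator_def)
        then show ?thesis by (simp only: tendsto_const)
      qed
    qed
  qed simp
  then have lim: "(\<lambda>n. 2 * (LINT s:{0..T}|lborel. w n s)) \<longlonglongrightarrow> 2 * 0"
    by (intro tendsto_mult_left) (simp add: set_lebesgue_integral_def)
  have "\<bar>h T\<bar> \<le> 2 * 0"
    using lim by (rule LIMSEQ_le_const) (use bound in auto)
  then show "max 0 (d T) = (LINT s:{0..T}|lborel. if 0 < d s then g s else 0)"
    by (simp add: h_def q_def p_def)
qed

text \<open>
  The stochastic equation for a single sample point: \<open>z\<close> is the path of the driving process,
  \<open>f\<close> that of the solution.
\<close>

definition solves_path :: "(real \<Rightarrow> real) \<Rightarrow> real \<Rightarrow> (real \<Rightarrow> real) \<Rightarrow> (real \<Rightarrow> real) \<Rightarrow> bool" where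
  "solves_path a x z f \<longleftrightarrow> (\<forall>T>0. set_integrable lborel {0..T} (\<lambda>s. a (f s))) \<and>
      (\<forall>t\<ge>0. f t = x + (LINT s:{0..t}|lborel. a (f s)) + z t)"

text \<open>
  The drifts \<open>a (f s)\<close> and \<open>a (g s)\<close> agree wherever \<open>f s = g s\<close>. So the positive part of \<open>g - f\<close>
  has the density \<open>a (g s) - a (f s)\<close> on \<open>{g > f}\<close> and \<open>0\<close> elsewhere, and adding it to the drift of
  \<open>f\<close> gives the drift of the maximum. This is where it matters that the equation is
  one-dimensional with additive noise.
\<close>

lemma solves_path_max:
  assumes f: "solves_path a x z f" and g: "solves_path a x z g"
  shows "solves_path a x z (\<lambda>t. max (f t) (g t))"
proof -
  define c where "c = (\<lambda>s. a (g s) - a (f s))"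
  have int: "set_integrable lborel {0..T} (\<lambda>s. a (f s))" "set_integrable lborel {0..T} (\<lambda>s. a (g s))"
    if "0 \<le> T" for T
    using f g that set_integrable_subset[of lborel "{0..1}" _ "{0..T}"]
    by (cases "T = 0"; force simp: solves_path_def)+
  have ci: "set_integrable lborel {0..T} c" if "0 \<le> T" for T
    using int[OF that] by (simp add: c_def set_integral_diff)
  have diff: "(LINT s:{0..t}|lborel. c s) = g t - f t" if "0 \<le> t" for t
  proof -
    have "(LINT s:{0..t}|lborel. c s) = (LINT s:{0..t}|lborel. a (g s)) - (LINT s:{0..t}|lborel. a (f s))"
      using int[OF that] by (simp add: c_def set_integral_diff)
    then show ?thesis using f g that by (simp add: solves_path_def)
  qed
  have main: "set_integrable lborel {0..T} (\<lambda>s. a (max (f s) (g s))) \<and>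
    max (f T) (g T) = x + (LINT s:{0..T}|lborel. a (max (f s) (g s))) + z T" if T: "0 \<le> T" for T
  proof -
    define p where "p = (\<lambda>s. if 0 < (LINT r:{0..s}|lborel. c r) then c s else 0)"
    have z: "c s = 0" if "s \<in> {0..T}" "(LINT r:{0..s}|lborel. c r) = 0" for s
      using that diff[of s] by (simp add: c_def)
    note pp = positive_part_of_integral[OF T ci[OF T] z, folded p_def]
    have eq: "a (max (f s) (g s)) = a (f s) + p s" if "s \<in> {0..T}" for s
      using that diff[of s] by (auto simp: p_def c_def max_def)
    have eqf: "(\<lambda>s. indicator {0..T} s *\<^sub>R a (max (f s) (g s)))
       = (\<lambda>s. indicator {0..T} s *\<^sub>R (a (f s) + p s))"
      by (auto simp: indicator_def eq)
    have "set_integrable lborel {0..T} (\<lambda>s. a (f s) + p s)"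
      by (intro set_integral_add int T pp)
    moreover have "(LINT s:{0..T}|lborel. a (f s) + p s) = (LINT s:{0..T}|lborel. a (f s)) + max 0 (g T - f T)"
      using pp int[OF T] diff[OF T] by (simp add: set_integral_add)
    moreover have "f T = x + (LINT s:{0..T}|lborel. a (f s)) + z T"
      using f T by (simp add: solves_path_def)
    ultimately show ?thesis
      unfolding set_integrable_def set_lebesgue_integral_def eqf by auto
  qed
  then show ?thesis by (auto simp: solves_path_def)
qed

section \<open>Weak uniqueness on arbitrary spaces and pathwise uniqueness\<close>

lemma sde_solution_iff_solves_path:
  "sde_solution a x M F Z \<xi> \<longleftrightarrow>
    adapted F \<xi> \<and> (AE \<omega> in M. solves_path a x (\<lambda>t. Z t \<omega>) (\<lambda>t. \<xi> t \<omega>))"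
  by (simp add: sde_solution_def solves_path_def)

lemma (in filtered_prob_space) adapted_measurable:
  assumes "adapted F X" "0 \<le> t"
  shows "X t \<in> borel_measurable M"
  using assms subalgebra_F[of t] by (auto simp: adapted_def intro: measurable_from_subalg)

lemma process_law_distr:
  assumes f: "f \<in> measurable N M" "distr N M f = M"
    and X: "\<And>t. 0 \<le> t \<Longrightarrow> X t \<in> borel_measurable M"
  shows "process_law M X = process_law N (\<lambda>t \<omega>. X t (f \<omega>))"
proof -
  have "(\<lambda>\<omega>. \<lambda>t\<in>{0..}. X t \<omega>) \<in> measurable M (Pi\<^sub>M {0..} (\<lambda>_. borel))"
    using X by (intro measurable_restrict) auto
  then have "distr (distr N M f) (Pi\<^sub>M {0..} (\<lambda>_. borel)) (\<lambda>\<omega>. \<lambda>t\<in>{0..}. X t \<omega>)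
    = distr N (Pi\<^sub>M {0..} (\<lambda>_. borel)) (\<lambda>\<omega>. \<lambda>t\<in>{0..}. X t (f \<omega>))"
    using f(1) by (simp add: distr_distr comp_def)
  then show ?thesis by (simp add: process_law_def f(2))
qed

text \<open>
  The largest \<open>\<sigma>\<close>-algebra on the image of \<open>f\<close> that makes \<open>f\<close> measurable.
\<close>

definition final_algebra :: "('a \<Rightarrow> 'b) \<Rightarrow> 'a measure \<Rightarrow> 'b measure" where
  "final_algebra f N = sigma (f ` space N) {A. A \<subseteq> f ` space N \<and> f -` A \<inter> space N \<in> sets N}"

lemma space_final_algebra [simp]: "space (final_algebra f N) = f ` space N"
  unfolding final_algebra_def by (rule space_measure_of) auto

lemma sets_final_algebra:
  "sets (final_algebra f N) = {A. A \<subseteq> f ` space N \<and> f -` A \<inter> space N \<in> sets N}"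
proof -
  have "sigma_algebra (f ` space N) {A. A \<subseteq> f ` space N \<and> f -` A \<inter> space N \<in> sets N}"
  proof (unfold sigma_algebra_iff2, intro conjI ballI allI impI)
    fix A assume "A \<in> {A. A \<subseteq> f ` space N \<and> f -` A \<inter> space N \<in> sets N}"
    moreover have "f -` (f ` space N - A) \<inter> space N = space N - (f -` A \<inter> space N)" by auto
    ultimately show "f ` space N - A \<in> {A. A \<subseteq> f ` space N \<and> f -` A \<inter> space N \<in> sets N}" by auto
  next
    fix A :: "nat \<Rightarrow> _"
    assume "range A \<subseteq> {A. A \<subseteq> f ` space N \<and> f -` A \<inter> space N \<in> sets N}"
    moreover have "f -` (\<Union>i. A i) \<inter> space N = (\<Union>i. f -` A i \<inter> space N)" by auto
    moreover have "(\<Union>i. f -` A i \<inter> space N) \<in> sets N"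
      using calculation(1) by (intro sets.countable_UN) auto
    ultimately show "(\<Union>i. A i) \<in> {A. A \<subseteq> f ` space N \<and> f -` A \<inter> space N \<in> sets N}" by auto
  qed auto
  then show ?thesis unfolding final_algebra_def by (rule sigma_algebra.sets_measure_of_eq)
qed

lemma measurable_final_algebra: "f \<in> measurable N (final_algebra f N)"
  by (rule measurableI) (auto simp: sets_final_algebra)

lemma measurable_from_final_algebra:
  assumes "(\<lambda>\<omega>. g (f \<omega>)) \<in> measurable N K"
  shows "g \<in> measurable (final_algebra f N) K"
proof (rule measurableI)
  fix A assume "A \<in> sets K"
  moreover have "f -` (g -` A \<inter> f ` space N) \<inter> space N = (\<lambda>\<omega>. g (f \<omega>)) -` A \<inter> space N" by auto
  ultimately show "g -` A \<inter> space (final_algebra f N) \<in> sets (final_algebra f N)"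
    using measurable_sets[OF assms] by (auto simp: sets_final_algebra)
qed (use measurable_space[OF assms] in auto)

text \<open>
  The space of path pairs carries the image measure under \<open>\<omega> \<mapsto> (\<xi> \<omega>, Z \<omega>)\<close>, and the image of each
  \<open>\<sigma>\<close>-algebra is the final one. Everything then pulls back verbatim: a set of path pairs is measurable
  exactly when its preimage is. The measure is completed first, because the set where the
  equation holds contains a measurable set of full measure but need not itself be measurable.
\<close>

lemma weak_solution_on_path_pairs:
  fixes M :: "'w measure"
  assumes ws: "weak_solution a x L M F Z \<xi>"
  shows "\<exists>(M' :: path_pair measure) F' Z' \<xi>'.
    weak_solution a x L M' F' Z' \<xi>' \<and> process_law M' \<xi>' = process_law M \<xi>"
proof -
  interpret levy_process M F Z using ws by (simp add: weak_solution_def)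
  have sol: "adapted F \<xi>" "AE \<omega> in M. solves_path a x (\<lambda>t. Z t \<omega>) (\<lambda>t. \<xi> t \<omega>)"
    and law: "process_law M Z = L"
    using ws by (auto simp: weak_solution_def sde_solution_iff_solves_path)
  define \<Phi> :: "'w \<Rightarrow> path_pair" where "\<Phi> = (\<lambda>\<omega>. ((\<lambda>t. \<xi> t \<omega>), (\<lambda>t. Z t \<omega>)))"
  define C where "C = completion M"
  define M' where "M' = distr C (final_algebra \<Phi> C) \<Phi>"
  define F' where "F' = (\<lambda>t. final_algebra \<Phi> (F t))"
  define Z' :: "real \<Rightarrow> path_pair \<Rightarrow> real" where "Z' = (\<lambda>t w. snd w t)"
  define \<xi>' :: "real \<Rightarrow> path_pair \<Rightarrow> real" where "\<xi>' = (\<lambda>t w. fst w t)"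
  have \<Phi>m: "\<Phi> \<in> measurable C M'"
    unfolding M'_def using measurable_final_algebra by simp
  have sM: "space C = space M" "space M' = \<Phi> ` space M" by (auto simp: C_def M'_def)
  have setsM': "sets M' = {A. A \<subseteq> \<Phi> ` space M \<and> \<Phi> -` A \<inter> space M \<in> sets C}"
    unfolding M'_def by (simp add: sets_final_algebra sM)
  have sF: "space (F t) = space M" if "0 \<le> t" for t
    using subalgebra_F[OF that] by (simp add: subalgebra_def)
  have setsF': "sets (F' t) = {A. A \<subseteq> \<Phi> ` space M \<and> \<Phi> -` A \<inter> space M \<in> sets (F t)}"
    if "0 \<le> t" for t
    unfolding F'_def by (simp add: sets_final_algebra sF[OF that])
  have comp: "Z' t (\<Phi> \<omega>) = Z t \<omega>" "\<xi>' t (\<Phi> \<omega>) = \<xi> t \<omega>" for t \<omega>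
    by (simp_all add: Z'_def \<xi>'_def \<Phi>_def)
  interpret M': prob_space M'
    unfolding M'_def C_def
    by (intro prob_space.prob_space_distr prob_space_completion measurable_final_algebra prob_space_axioms)
  have distr: "distr C M' \<Phi> = M'" unfolding M'_def by (rule distr_cong) auto
  have M'I: "Y \<in> borel_measurable M'" "distr M' borel Y = distr M borel (\<lambda>\<omega>. Y (\<Phi> \<omega>))"
    if "(\<lambda>\<omega>. Y (\<Phi> \<omega>)) \<in> borel_measurable M" for Y :: "path_pair \<Rightarrow> real"
  proof -
    have c: "(\<lambda>\<omega>. Y (\<Phi> \<omega>)) \<in> borel_measurable C" using that unfolding C_def by (rule measurable_completion)
    then have "Y \<in> borel_measurable (final_algebra \<Phi> C)" by (rule measurable_from_final_algebra)
    then show Y: "Y \<in> borel_measurable M'" by (simp add: M'_def)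
    have "distr (distr C M' \<Phi>) borel Y = distr C borel (\<lambda>\<omega>. Y (\<Phi> \<omega>))"
      using \<Phi>m Y by (simp add: distr_distr comp_def)
    then show "distr M' borel Y = distr M borel (\<lambda>\<omega>. Y (\<Phi> \<omega>))"
      using that unfolding distr by (simp add: C_def distr_completion)
  qed
  have FC: "sets (F t) \<subseteq> sets C" if "0 \<le> t" for t
    using subalgebra_F[OF that] by (auto simp: subalgebra_def C_def)
  have filt: "filtered_prob_space M' F'"
  proof
    fix t :: real assume t: "0 \<le> t"
    show "subalgebra M' (F' t)"
      using FC[OF t] sF[OF t] unfolding subalgebra_def setsF'[OF t] setsM'
      by (auto simp: sM F'_def)
  next
    fix s t :: real assume "0 \<le> s" "s \<le> t"
    then show "sets (F' s) \<subseteq> sets (F' t)"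
      using F_mono[of s t] by (auto simp: setsF')
  qed
  have Zm: "Z t \<in> borel_measurable M" if "0 \<le> t" for t
    using adapted_measurable[OF adapted_Z that] .
  have meas: "measure M' A = prob (\<Phi> -` A \<inter> space M)" if "A \<in> sets M'" "\<Phi> -` A \<inter> space M \<in> sets M" for A
  proof -
    have "measure M' A = measure (distr C M' \<Phi>) A" by (simp add: distr)
    also have "\<dots> = measure C (\<Phi> -` A \<inter> space C)" by (rule measure_distr[OF \<Phi>m that(1)])
    finally show ?thesis using that by (simp add: sM) (simp add: C_def)
  qed
  have levy: "levy_process M' F' Z'"
  proof (intro levy_process.intro filt levy_process_axioms.intro)
    show "adapted F' Z'"
      using adapted_Z unfolding adapted_def F'_def
      by (auto intro!: measurable_from_final_algebra simp: comp)
  next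
    fix w assume "w \<in> space M'"
    then show "cadlag (\<lambda>t. Z' t w)" "Z' 0 w = 0"
      using cadlag_Z Z_zero by (auto simp: sM comp)
  next
    fix s t :: real assume st: "0 \<le> s" "0 \<le> t"
    have "(\<lambda>w. Z t (w) - Z s w) \<in> borel_measurable M" if "0 \<le> t" "0 \<le> s" for t s
      using Zm that by measurable
    then have *: "distr M' borel (\<lambda>w. Z' t w - Z' s w) = distr M borel (\<lambda>\<omega>. Z t \<omega> - Z s \<omega>)"
      if "0 \<le> t" "0 \<le> s" for t s
      using that by (subst M'I) (auto simp: comp)
    show "distr M' borel (\<lambda>\<omega>. Z' (t + s) \<omega> - Z' t \<omega>) = distr M' borel (\<lambda>\<omega>. Z' s \<omega> - Z' 0 \<omega>)"
      using stationary_increments[OF st] st by (simp add: *)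
    have Z'm: "Z' t \<in> borel_measurable M'" if "0 \<le> t" for t
      using Zm[OF that] by (intro M'I) (simp add: comp)
    show "M'.indep_set {(\<lambda>\<omega>. Z' (t + s) \<omega> - Z' t \<omega>) -` A \<inter> space M' |A. A \<in> sets borel} (sets (F' t))"
      unfolding M'.indep_sets2_eq
    proof (intro conjI ballI)
      have "(\<lambda>\<omega>. Z' (t + s) \<omega> - Z' t \<omega>) \<in> borel_measurable M'"
        using Z'm[of t] Z'm[of "t + s"] st by (intro borel_measurable_diff) auto
      note inc = measurable_sets[OF this]
      show "{(\<lambda>\<omega>. Z' (t + s) \<omega> - Z' t \<omega>) -` A \<inter> space M' |A. A \<in> sets borel} \<subseteq> M'.events"
        using inc by auto
      show "sets (F' t) \<subseteq> M'.events"
        using filtered_prob_space.subalgebra_F[OF filt st(2)] by (simp add: subalgebra_def)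
      fix A B assume A: "A \<in> {(\<lambda>\<omega>. Z' (t + s) \<omega> - Z' t \<omega>) -` A \<inter> space M' |A. A \<in> sets borel}"
        and B: "B \<in> sets (F' t)"
      then obtain H where H: "H \<in> sets borel" "A = (\<lambda>\<omega>. Z' (t + s) \<omega> - Z' t \<omega>) -` H \<inter> space M'" by auto
      have AM: "A \<in> M'.events" and BM: "B \<in> M'.events"
        using H inc B \<open>sets (F' t) \<subseteq> M'.events\<close> by auto
      have pA: "\<Phi> -` A \<inter> space M = (\<lambda>\<omega>. Z (t + s) \<omega> - Z t \<omega>) -` H \<inter> space M"
        unfolding H(2) sM(2) by (rule set_eqI, simp add: comp, blast)
      have pB: "\<Phi> -` B \<inter> space M \<in> sets (F t)" using B by (simp add: setsF' st)
      then have pBM: "\<Phi> -` B \<inter> space M \<in> sets M"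
        using subalgebra_F[OF st(2)] by (auto simp: subalgebra_def)
      have "(\<lambda>\<omega>. Z (t + s) \<omega> - Z t \<omega>) \<in> borel_measurable M"
        using Zm[of t] Zm[of "t + s"] st by (intro borel_measurable_diff) auto
      then have pAM: "\<Phi> -` A \<inter> space M \<in> sets M"
        unfolding pA using H(1) by (rule measurable_sets)
      have AB: "\<Phi> -` (A \<inter> B) \<inter> space M = (\<Phi> -` A \<inter> space M) \<inter> (\<Phi> -` B \<inter> space M)" by auto
      have "prob ((\<Phi> -` A \<inter> space M) \<inter> (\<Phi> -` B \<inter> space M)) = prob (\<Phi> -` A \<inter> space M) * prob (\<Phi> -` B \<inter> space M)"
        using independent_increments[OF st] pB H(1) unfolding indep_sets2_eq pA by blast
      then show "M'.prob (A \<inter> B) = M'.prob A * M'.prob B"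
        using meas[OF AM pAM] meas[OF BM pBM]
          meas[of "A \<inter> B", unfolded AB, OF sets.Int[OF AM BM] sets.Int[OF pAM pBM]]
        by (simp only:)
    qed
  qed
  have law': "process_law M' X' = process_law M X"
    if "\<And>t. 0 \<le> t \<Longrightarrow> X t \<in> borel_measurable M" "\<And>t \<omega>. X' t (\<Phi> \<omega>) = X t \<omega>" for X X'
  proof -
    have "process_law M' X' = process_law C X"
      using that by (subst process_law_distr[OF \<Phi>m distr]) (auto intro!: M'I)
    moreover have "(\<lambda>\<omega>. \<lambda>t\<in>{0..}. X t \<omega>) \<in> measurable M (Pi\<^sub>M {0..} (\<lambda>_. borel))"
      using that by (intro measurable_restrict) auto
    ultimately show ?thesis by (simp add: process_law_def C_def distr_completion)
  qed
  have ad: "adapted F' \<xi>'"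
    using sol(1) unfolding adapted_def F'_def
    by (auto intro!: measurable_from_final_algebra simp: comp)
  have ae: "AE w in M'. solves_path a x (\<lambda>t. Z' t w) (\<lambda>t. \<xi>' t w)"
  proof -
    define N where "N = {w \<in> space M'. \<not> solves_path a x (\<lambda>t. Z' t w) (\<lambda>t. \<xi>' t w)}"
    have pN: "\<Phi> -` N \<inter> space M = {\<omega> \<in> space M. \<not> solves_path a x (\<lambda>t. Z t \<omega>) (\<lambda>t. \<xi> t \<omega>)}"
      by (auto simp: N_def sM comp)
    obtain N0 where N0: "{\<omega> \<in> space M. \<not> solves_path a x (\<lambda>t. Z t \<omega>) (\<lambda>t. \<xi> t \<omega>)} \<subseteq> N0" "N0 \<in> null_sets M"
      using sol(2) unfolding eventually_ae_filter by blast
    then have null: "\<Phi> -` N \<inter> space M \<in> null_sets C"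
      unfolding C_def pN by (rule null_sets_completion_subset[OF _ null_sets_completionI])
    then have N: "N \<in> sets M'" by (auto simp: setsM' N_def sM)
    have "emeasure M' N = emeasure (distr C M' \<Phi>) N" by (simp add: distr)
    also have "\<dots> = 0" using null by (subst emeasure_distr[OF \<Phi>m N]) (auto simp: sM)
    finally show ?thesis using N by (intro AE_I[of _ _ N]) (auto simp: N_def)
  qed
  have "weak_solution a x L M' F' Z' \<xi>'"
    unfolding weak_solution_def sde_solution_iff_solves_path
    using levy ad ae law law'[OF Zm comp(1)] by simp
  moreover have "process_law M' \<xi>' = process_law M \<xi>"
    by (rule law'[OF adapted_measurable[OF sol(1)] comp(2)])
  ultimately show ?thesis by blast
qed

lemma weak_solution_law_unique:
  assumes "weak_solution_unique a x L" "weak_solution a x L M F Z \<xi>" "weak_solution a x L N G W \<eta>"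
  shows "process_law M \<xi> = process_law N \<eta>"
proof -
  obtain M' :: "path_pair measure" and F' Z' \<xi>' where 1: "weak_solution a x L M' F' Z' \<xi>'"
    "process_law M' \<xi>' = process_law M \<xi>"
    using weak_solution_on_path_pairs[OF assms(2)] by blast
  obtain N' :: "path_pair measure" and G' W' \<eta>' where 2: "weak_solution a x L N' G' W' \<eta>'"
    "process_law N' \<eta>' = process_law N \<eta>"
    using weak_solution_on_path_pairs[OF assms(3)] by blast
  have "process_law M' \<xi>' = process_law N' \<eta>'"
    using assms(1) 1(1) 2(1) unfolding weak_solution_unique_def by blast
  then show ?thesis using 1 2 by simp
qed

lemma process_law_marginal:
  assumes "\<And>t. 0 \<le> t \<Longrightarrow> X t \<in> borel_measurable M" and "0 \<le> t"
  shows "distr (process_law M X) borel (\<lambda>f. f t) = distr M borel (X t)"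
proof -
  have "(\<lambda>\<omega>. \<lambda>t\<in>{0..}. X t \<omega>) \<in> measurable M (Pi\<^sub>M {0..} (\<lambda>_. borel))"
    using assms by (intro measurable_restrict) auto
  moreover have "(\<lambda>f. f t) \<in> measurable (Pi\<^sub>M {0..} (\<lambda>_. borel)) borel"
    using assms by (intro measurable_component_singleton) auto
  ultimately show ?thesis
    using assms by (simp add: process_law_def distr_distr comp_def)
qed

text \<open>
  The expectations of a bounded strictly increasing function of \<open>X\<close> and \<open>Y\<close> coincide.
\<close>

lemma (in prob_space) AE_eq_if_le_and_same_distr:
  fixes X Y :: "'a \<Rightarrow> real"
  assumes X: "X \<in> borel_measurable M" and Y: "Y \<in> borel_measurable M"
    and le: "\<And>\<omega>. X \<omega> \<le> Y \<omega>" and eq: "distr M borel X = distr M borel Y"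
  shows "AE \<omega> in M. X \<omega> = Y \<omega>"
proof -
  have bd: "\<bar>arctan y\<bar> \<le> 2" for y
    using arctan_lbound[of y] arctan_ubound[of y] pi_half_less_two by (simp add: abs_le_iff)
  have [measurable]: "arctan \<in> borel_measurable borel"
    by (intro borel_measurable_continuous_onI continuous_intros)
  have iX: "integrable M (\<lambda>\<omega>. arctan (X \<omega>))" and iY: "integrable M (\<lambda>\<omega>. arctan (Y \<omega>))"
    using X Y bd by (auto intro!: integrable_const_bound[where B=2])
  have "(LINT \<omega>|M. arctan (X \<omega>)) = (LINT \<omega>|distr M borel X. arctan \<omega>)"
    using X by (subst integral_distr) auto
  also have "\<dots> = (LINT \<omega>|M. arctan (Y \<omega>))"
    unfolding eq using Y by (subst integral_distr) auto
  finally have "(LINT \<omega>|M. arctan (Y \<omega>) - arctan (X \<omega>)) = 0" using iX iY by simp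
  then have "AE \<omega> in M. arctan (Y \<omega>) - arctan (X \<omega>) = 0"
    using iX iY le by (subst (asm) integral_nonneg_eq_0_iff_AE) (auto simp: arctan_le_iff)
  then show ?thesis by eventually_elim (simp add: arctan_eq_iff)
qed

text \<open>
  With \<open>\<xi>\<close> and \<open>\<eta>\<close> also their maximum is a weak solution, so by weak uniqueness it has the law of
  both; being at least as large as either, it is almost surely equal to either.
\<close>

lemma pathwise_uniqueness:
  assumes uniq: "weak_solution_unique a x L"
    and \<xi>: "weak_solution a x L M F Z \<xi>" and \<eta>: "weak_solution a x L M F Z \<eta>" and t: "0 \<le> t"
  shows "AE \<omega> in M. \<xi> t \<omega> = \<eta> t \<omega>"
proof -
  interpret levy_process M F Z using \<xi> by (simp add: weak_solution_def)
  define \<mu> where "\<mu> = (\<lambda>t \<omega>. max (\<xi> t \<omega>) (\<eta> t \<omega>))"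
  have ad: "adapted F \<xi>" "adapted F \<eta>"
    and ae: "AE \<omega> in M. solves_path a x (\<lambda>t. Z t \<omega>) (\<lambda>t. \<xi> t \<omega>)"
      "AE \<omega> in M. solves_path a x (\<lambda>t. Z t \<omega>) (\<lambda>t. \<eta> t \<omega>)"
    using \<xi> \<eta> by (auto simp: weak_solution_def sde_solution_iff_solves_path)
  have ad\<mu>: "adapted F \<mu>" using ad by (simp add: adapted_def \<mu>_def borel_measurable_max)
  have "AE \<omega> in M. solves_path a x (\<lambda>t. Z t \<omega>) (\<lambda>t. \<mu> t \<omega>)"
    using ae by eventually_elim (auto simp: \<mu>_def intro: solves_path_max)
  then have \<mu>: "weak_solution a x L M F Z \<mu>"
    using \<xi> ad\<mu> by (auto simp: weak_solution_def sde_solution_iff_solves_path)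
  have d: "distr M borel (X t) = distr M borel (\<mu> t)"
    if "weak_solution a x L M F Z X" for X
  proof -
    have "adapted F X" using that by (simp add: weak_solution_def sde_solution_def)
    note m = adapted_measurable[OF this] and m\<mu> = adapted_measurable[OF ad\<mu>]
    show ?thesis
      using process_law_marginal[where X=X, OF m t] process_law_marginal[where X=\<mu>, OF m\<mu> t]
        weak_solution_law_unique[OF uniq that \<mu>] by simp
  qed
  have "AE \<omega> in M. X t \<omega> = \<mu> t \<omega>"
    if "weak_solution a x L M F Z X" "adapted F X" "\<And>\<omega>. X t \<omega> \<le> \<mu> t \<omega>" for X
    using that(3) d[OF that(1)]
    by (intro AE_eq_if_le_and_same_distr adapted_measurable[OF that(2) t] adapted_measurable[OF ad\<mu> t])
  from this[OF \<xi> ad(1)] this[OF \<eta> ad(2)]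
  have "AE \<omega> in M. \<xi> t \<omega> = \<mu> t \<omega>" "AE \<omega> in M. \<eta> t \<omega> = \<mu> t \<omega>"
    by (simp_all add: \<mu>_def)
  then show ?thesis by eventually_elim simp
qed

section \<open>Conditionally independent copies of a real random variable\<close>

text \<open>
  A sequence of bits is coded by a number with only the digits \<open>0\<close> and \<open>1\<close> in base \<open>3\<close>. In contrast
  to base \<open>2\<close>, the tail of such an expansion stays below one unit of the previous digit, so the digits
  can be read off by rounding down.
\<close>

definition ternary_code :: "(nat \<Rightarrow> bool) \<Rightarrow> real" where
  "ternary_code b = (\<Sum>n. of_bool (b n) * (1/3) ^ Suc n)"

definition ternary_digit :: "nat \<Rightarrow> real \<Rightarrow> bool" where
  "ternary_digit n y \<longleftrightarrow> \<lfloor>3 ^ Suc n * y\<rfloor> mod 3 = 1"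

lemma summable_ternary: "summable (\<lambda>n. of_bool (b n) * (1/3 :: real) ^ Suc n)"
proof (rule summable_comparison_test)
  show "\<exists>N. \<forall>n\<ge>N. norm (of_bool (b n) * (1/3 :: real) ^ Suc n) \<le> (1/3) ^ Suc n"
    by (auto simp: of_bool_def)
  show "summable (\<lambda>n. (1/3 :: real) ^ Suc n)"
    by (intro summable_mult summable_geometric[of "1/3 :: real", simplified] | simp)+
qed

lemma ternary_code_bounds: "0 \<le> ternary_code b" "ternary_code b \<le> 1/2"
proof -
  show "0 \<le> ternary_code b" unfolding ternary_code_def by (intro suminf_nonneg summable_ternary) simp
  have s: "(\<lambda>n. (1/3 :: real) * (1/3) ^ n) sums (1/3 * (1 / (1 - 1/3)))"
    by (intro sums_mult geometric_sums) simp
  have "ternary_code b \<le> (\<Sum>n. (1/3 :: real) * (1/3) ^ n)"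
    unfolding ternary_code_def using summable_ternary[of b] s
    by (intro suminf_le) (auto simp: of_bool_def sums_iff)
  also have "\<dots> = 1/2" using s by (simp add: sums_iff)
  finally show "ternary_code b \<le> 1/2" .
qed

lemma ternary_code_shift: "3 * ternary_code b = of_bool (b 0) + ternary_code (\<lambda>n. b (Suc n))"
proof -
  have "ternary_code b = (\<Sum>n. of_bool (b (Suc n)) * (1/3) ^ Suc (Suc n)) + of_bool (b 0) * (1/3) ^ Suc 0"
    unfolding ternary_code_def using suminf_split_head[OF summable_ternary[of b]] by simp
  also have "(\<Sum>n. of_bool (b (Suc n)) * (1/3 :: real) ^ Suc (Suc n)) = (\<Sum>n. (1/3) * (of_bool (b (Suc n)) * (1/3) ^ Suc n))"
    by (intro suminf_cong) simp
  also have "\<dots> = 1/3 * ternary_code (\<lambda>n. b (Suc n))"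
    unfolding ternary_code_def by (intro suminf_mult summable_ternary)
  finally show ?thesis by simp
qed

lemma ternary_digit_code [simp]: "ternary_digit n (ternary_code b) = b n"
proof (induction n arbitrary: b)
  case 0
  have "\<lfloor>of_bool (b 0) + ternary_code (\<lambda>n. b (Suc n))\<rfloor> = of_bool (b 0)"
    using ternary_code_bounds[of "\<lambda>n. b (Suc n)"] by (intro floor_unique) auto
  then show ?case by (simp add: ternary_digit_def ternary_code_shift)
next
  case (Suc n)
  have "3 ^ Suc (Suc n) * ternary_code b = 3 ^ Suc n * (3 * ternary_code b)" by simp
  also have "\<dots> = real_of_int (3 ^ Suc n * of_bool (b 0)) + 3 ^ Suc n * ternary_code (\<lambda>n. b (Suc n))"
    unfolding ternary_code_shift by (simp add: algebra_simps)
  finally have "\<lfloor>3 ^ Suc (Suc n) * ternary_code b\<rfloor>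
      = 3 * (3 ^ n * of_bool (b 0)) + \<lfloor>3 ^ Suc n * ternary_code (\<lambda>n. b (Suc n))\<rfloor>"
    by (simp only: int_add_floor[symmetric] power_Suc mult.assoc)
  then have "\<lfloor>3 ^ Suc (Suc n) * ternary_code b\<rfloor> mod 3
      = \<lfloor>3 ^ Suc n * ternary_code (\<lambda>n. b (Suc n))\<rfloor> mod 3" by simp
  then show ?case using Suc[of "\<lambda>n. b (Suc n)"] by (simp only: ternary_digit_def)
qed

text \<open>
  A real number is recovered from the bits that tell which rationals lie above it.
\<close>

lemma INF_rat_above: "(INF q. if x < real_of_rat q then ereal (real_of_rat q) else \<infinity>) = ereal x"
proof (rule antisym)
  show "(INF q. if x < real_of_rat q then ereal (real_of_rat q) else \<infinity>) \<le> ereal x"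
  proof (rule dense_ge)
    fix y :: ereal assume "ereal x < y"
    then obtain z where z: "ereal x < ereal z" "ereal z \<le> y" 
      using ereal_dense2[of "ereal x" y] less_imp_le by blast
    then obtain q where q: "x < real_of_rat q" "real_of_rat q < z" using of_rat_dense by auto
    have "(INF q. if x < real_of_rat q then ereal (real_of_rat q) else \<infinity>)
       \<le> (if x < real_of_rat q then ereal (real_of_rat q) else \<infinity>)" by (rule INF_lower) simp
    also have "\<dots> \<le> ereal z" using q by simp
    finally show "(INF q. if x < real_of_rat q then ereal (real_of_rat q) else \<infinity>) \<le> y" using z by simp
  qed
qed (rule INF_greatest, simp)

text \<open>
  Countably many real random variables carry the same information as a single bounded one. This
  reduces the conditional distribution of a whole process to that of a real variable, which
  has a distribution function.
\<close>

lemma real_code_of_sequence: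
  fixes X :: "'i::countable \<Rightarrow> 'w \<Rightarrow> real"
  assumes X[measurable]: "\<And>i. X i \<in> borel_measurable M"
  shows "\<exists>(Y :: 'w \<Rightarrow> real) (d :: 'i \<Rightarrow> real \<Rightarrow> real).
    Y \<in> borel_measurable M \<and> (\<forall>\<omega>. 0 \<le> Y \<omega> \<and> Y \<omega> \<le> 1) \<and>
    (\<forall>i. d i \<in> borel_measurable borel) \<and> (\<forall>i \<omega>. d i (Y \<omega>) = X i \<omega>)"
proof (intro exI conjI allI)
  define b where "b = (\<lambda>\<omega> n. X (fst (from_nat n :: 'i \<times> rat)) \<omega> < real_of_rat (snd (from_nat n :: 'i \<times> rat)))"
  define d where "d = (\<lambda>(i::'i) y. real_of_ereal
    (INF q. if ternary_digit (to_nat (i, q)) y then ereal (real_of_rat q) else \<infinity>))"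
  show "(\<lambda>\<omega>. ternary_code (b \<omega>)) \<in> borel_measurable M"
    unfolding ternary_code_def b_def of_bool_def by measurable
  show "0 \<le> ternary_code (b \<omega>)" "ternary_code (b \<omega>) \<le> 1" for \<omega>
    using ternary_code_bounds[of "b \<omega>"] by simp_all
  show "d i \<in> borel_measurable borel" for i
    unfolding d_def ternary_digit_def by measurable
  show "d i (ternary_code (b \<omega>)) = X i \<omega>" for i \<omega>
  proof -
    have "ternary_digit (to_nat (i, q)) (ternary_code (b \<omega>)) \<longleftrightarrow> X i \<omega> < real_of_rat q" for q
      by (simp add: b_def)
    then show ?thesis by (simp only: d_def prod.case INF_rat_above real_of_ereal.simps)
  qed
qed

text \<open>
  A conditional distribution function of \<open>Y\<close> given \<open>G\<close> at the rationals. The conditional expectations are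
  monotone in \<open>q\<close> only almost surely; on the exceptional null set, which belongs to \<open>G\<close>, they are replaced
  by the constant \<open>1\<close>.
\<close>

lemma (in prob_space) conditional_cdf:
  fixes Y :: "'a \<Rightarrow> real"
  assumes G: "subalgebra M G" and Y[measurable]: "Y \<in> borel_measurable M"
  obtains p :: "rat \<Rightarrow> 'a \<Rightarrow> real" where
    "\<And>q. p q \<in> borel_measurable G" "\<And>q \<omega>. 0 \<le> p q \<omega> \<and> p q \<omega> \<le> 1"
    "\<And>q q' \<omega>. q \<le> q' \<Longrightarrow> p q \<omega> \<le> p q' \<omega>"
    "\<And>q C. C \<in> sets G \<Longrightarrow>
      (LINT \<omega>:C|M. p q \<omega>) = prob (C \<inter> {\<omega>\<in>space M. Y \<omega> \<le> real_of_rat q})"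
proof -
  interpret finite_measure_subalgebra M G by standard (rule G)
  define S where "S = (\<lambda>q. {\<omega>\<in>space M. Y \<omega> \<le> real_of_rat q})"
  have [measurable]: "S q \<in> sets M" for q unfolding S_def by measurable
  define c where "c = (\<lambda>q. real_cond_exp M G (indicator (S q)))"
  define good where "good = (\<lambda>\<omega>. (\<forall>q. 0 \<le> c q \<omega> \<and> c q \<omega> \<le> 1) \<and> (\<forall>q q'. q \<le> q' \<longrightarrow> c q \<omega> \<le> c q' \<omega>))"
  define p where "p = (\<lambda>q \<omega>. if good \<omega> then c q \<omega> else 1)"
  have c[measurable]: "c q \<in> borel_measurable G" for q by (simp add: c_def)
  have int: "integrable M (indicator (S q) :: 'a \<Rightarrow> real)" for q
    by (intro integrable_real_indicator) (auto simp: less_top[symmetric])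
  have "AE \<omega> in M. 0 \<le> c q \<omega> \<and> c q \<omega> \<le> 1" for q
    using real_cond_exp_ge_c[OF int, of 0 q] real_cond_exp_le_c[OF int, of q 1]
    unfolding c_def by (auto simp: indicator_def)
  moreover have "AE \<omega> in M. q \<le> q' \<longrightarrow> c q \<omega> \<le> c q' \<omega>" for q q'
  proof (cases "q \<le> q'")
    case True
    then have "real_of_rat q \<le> real_of_rat q'" by (simp add: of_rat_less_eq)
    then have "AE \<omega> in M. (indicator (S q) \<omega> :: real) \<le> indicator (S q') \<omega>"
      by (intro AE_I2) (auto simp: S_def indicator_def)
    from real_cond_exp_mono[OF this int int] show ?thesis unfolding c_def by eventually_elim simp
  qed simp
  ultimately have "AE \<omega> in M. good \<omega>"
    unfolding good_def by (simp add: AE_all_countable)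
  then have cp: "AE \<omega> in M. c q \<omega> = p q \<omega>" for q
    by eventually_elim (simp add: p_def)
  show ?thesis
  proof (rule that[of p])
    show pm: "p q \<in> borel_measurable G" for q
      unfolding p_def good_def by measurable
    show "0 \<le> p q \<omega> \<and> p q \<omega> \<le> 1" for q \<omega> by (auto simp: p_def good_def)
    show "p q \<omega> \<le> p q' \<omega>" if "q \<le> q'" for q q' \<omega> using that by (auto simp: p_def good_def)
    fix q C assume C: "C \<in> sets G"
    then have CM: "C \<in> sets M" using G by (auto simp: subalgebra_def)
    have [measurable]: "c q \<in> borel_measurable M" "p q \<in> borel_measurable M"
      using c pm by (auto intro: measurable_from_subalg[OF G])
    have "(LINT \<omega>:C|M. p q \<omega>) = (LINT \<omega>:C|M. c q \<omega>)"
      using CM cp[of q] unfolding set_lebesgue_integral_def by (intro integral_cong_AE) auto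
    also have "\<dots> = (LINT \<omega>:C|M. indicator (S q) \<omega>)"
      unfolding c_def by (rule real_cond_exp_intA[OF int C, symmetric])
    also have "\<dots> = (LINT \<omega>|M. indicator (C \<inter> S q) \<omega>)"
      unfolding set_lebesgue_integral_def by (simp add: indicator_inter_arith)
    also have "\<dots> = prob (C \<inter> S q)" using CM by simp
    finally show "(LINT \<omega>:C|M. p q \<omega>) = prob (C \<inter> {\<omega>\<in>space M. Y \<omega> \<le> real_of_rat q})"
      by (simp add: S_def)
  qed
qed

abbreviation uniform01 :: "real measure" where
  "uniform01 \<equiv> uniform_measure lborel {0..1}"

lemma prob_space_uniform01: "prob_space uniform01"
  by (intro prob_space_uniform_measure) auto

lemma emeasure_uniform01_atMost: "0 \<le> c \<Longrightarrow> c \<le> 1 \<Longrightarrow> emeasure uniform01 {..c} = ennreal c"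
proof -
  assume "0 \<le> c" "c \<le> 1"
  moreover from this have "{0..1} \<inter> {..c} = {0..c}" by auto
  ultimately show ?thesis by (simp add: emeasure_uniform_measure divide_ennreal_def)
qed

lemma rat_sequence_below:
  "\<exists>q :: nat \<Rightarrow> rat. mono q \<and> (\<forall>n. real_of_rat (q n) < r) \<and> (\<forall>s<r. \<exists>n. s < real_of_rat (q n))"
proof -
  have "\<exists>q. \<forall>n. (r - 1 / real (Suc n) < real_of_rat (q n) \<and> real_of_rat (q n) < r) \<and> q n \<le> (q (Suc n) :: rat)"
  proof (rule dependent_nat_choice)
    show "\<exists>x. r - 1 / real (Suc 0) < real_of_rat x \<and> real_of_rat x < r" by (rule of_rat_dense) simp
  next
    fix x :: rat and n assume "r - 1 / real (Suc n) < real_of_rat x \<and> real_of_rat x < r"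
    then have "max (real_of_rat x) (r - 1 / real (Suc (Suc n))) < r" by auto
    then obtain y where "max (real_of_rat x) (r - 1 / real (Suc (Suc n))) < real_of_rat y" "real_of_rat y < r"
      using of_rat_dense by blast
    then show "\<exists>y. (r - 1 / real (Suc (Suc n)) < real_of_rat y \<and> real_of_rat y < r) \<and> x \<le> y"
      by (intro exI[of _ y]) (auto simp: of_rat_less intro: less_imp_le)
  qed
  then obtain q :: "nat \<Rightarrow> rat" where q: "\<And>n. r - 1 / real (Suc n) < real_of_rat (q n)"
    "\<And>n. real_of_rat (q n) < r" "\<And>n. q n \<le> q (Suc n)" by blast
  have "\<exists>n. s < real_of_rat (q n)" if "s < r" for s
  proof -
    obtain n where "1 / real (Suc n) < r - s" using nat_approx_posE[of "r - s"] \<open>s < r\<close> by auto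
    then show ?thesis using q(1)[of n] by (intro exI[of _ n]) linarith
  qed
  then show ?thesis using q(2,3) by (intro exI[of _ q]) (auto simp: mono_iff_le_Suc)
qed

text \<open>
  The quantile transform of the conditional distribution function turns an independent uniform
  variable into a variable \<open>Y'\<close> that has, jointly with \<open>G\<close>, the law of \<open>Y\<close>. Because \<open>Y'\<close> is a function of
  \<open>G\<close> and the uniform variable, it is moreover conditionally independent of all of \<open>M\<close> given \<open>G\<close>.
\<close>

lemma (in prob_space) conditional_copy:
  fixes Y :: "'a \<Rightarrow> real"
  assumes G: "subalgebra M G" and Y[measurable]: "Y \<in> borel_measurable M"
    and Y01: "\<And>\<omega>. 0 \<le> Y \<omega> \<and> Y \<omega> \<le> 1"
  obtains Y' :: "'a \<times> real \<Rightarrow> real" where "Y' \<in> borel_measurable (G \<Otimes>\<^sub>M borel)"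
    "distr (M \<Otimes>\<^sub>M uniform01) (G \<Otimes>\<^sub>M borel) (\<lambda>w. (fst w, Y' w)) = distr M (G \<Otimes>\<^sub>M borel) (\<lambda>\<omega>. (\<omega>, Y \<omega>))"
proof -
  obtain p :: "rat \<Rightarrow> 'a \<Rightarrow> real" where p[measurable]: "\<And>q. p q \<in> borel_measurable G"
    and p01: "\<And>q \<omega>. 0 \<le> p q \<omega> \<and> p q \<omega> \<le> 1"
    and pmono: "\<And>q q' \<omega>. q \<le> q' \<Longrightarrow> p q \<omega> \<le> p q' \<omega>"
    and pint: "\<And>q C. C \<in> sets G \<Longrightarrow>
      (LINT \<omega>:C|M. p q \<omega>) = prob (C \<inter> {\<omega>\<in>space M. Y \<omega> \<le> real_of_rat q})"
    by (rule conditional_cdf[OF G Y]) blast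
  interpret U: prob_space uniform01 by (rule prob_space_uniform01)
  interpret MU: pair_prob_space M uniform01 ..
  define N where "N = M \<Otimes>\<^sub>M uniform01"
  \<comment> \<open>The infimum over q of v q is the quantile, with q clamped to the range [0, 1] of Y;
    the value 1 stands for the infimum of the empty set.\<close>
  define v where "v = (\<lambda>q (w :: 'a \<times> real). if snd w \<le> p q (fst w) then max 0 (min 1 (real_of_rat q)) else 1)"
  define Y' where "Y' = (\<lambda>w. INF q. v q w)"
  have v01: "0 \<le> v q w" "v q w \<le> 1" for q w by (auto simp: v_def)
  have bdd: "bdd_below (range (\<lambda>q. v q w))" for w by (rule bdd_belowI2[of _ 0]) (rule v01)
  have v[measurable]: "v q \<in> borel_measurable (G \<Otimes>\<^sub>M borel)" for q unfolding v_def by measurable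
  have Y'[measurable]: "Y' \<in> borel_measurable (G \<Otimes>\<^sub>M borel)"
    unfolding Y'_def by (intro borel_measurable_cINF_real) auto
  have spG: "space G = space M" and setsG: "sets G \<subseteq> sets M" using G by (auto simp: subalgebra_def)
  have idG[measurable]: "(\<lambda>\<omega>. \<omega>) \<in> measurable M G"
    by (rule measurable_from_subalg[OF G]) simp
  have fstG[measurable]: "fst \<in> measurable N G"
    unfolding N_def by (rule measurable_compose[OF measurable_fst idG])
  have snd[measurable]: "snd \<in> borel_measurable N"
    unfolding N_def by (rule measurable_compose[OF measurable_snd]) simp
  have "(\<lambda>w. (fst w, snd w)) \<in> measurable N (G \<Otimes>\<^sub>M borel)" by measurable
  then have Y'N[measurable]: "Y' \<in> borel_measurable N"
    using measurable_compose[OF _ Y'] by fastforce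
  have lessY': "Y' w < r \<longleftrightarrow> (\<exists>q. real_of_rat q < r \<and> snd w \<le> p q (fst w))" if "0 < r" "r \<le> 1" for r w
  proof -
    have "Y' w < r \<longleftrightarrow> (\<exists>q. v q w < r)"
      unfolding Y'_def using cINF_less_iff[OF _ bdd] by auto
    also have "\<dots> \<longleftrightarrow> (\<exists>q. real_of_rat q < r \<and> snd w \<le> p q (fst w))"
    proof -
      have "max 0 (min 1 y) < r \<longleftrightarrow> y < r" for y :: real
        using that by (auto simp: max_def min_def)
      then have "v q w < r \<longleftrightarrow> real_of_rat q < r \<and> snd w \<le> p q (fst w)" for q
        using that by (simp add: v_def)
      then show ?thesis by simp
    qed
    finally show ?thesis .
  qed
  have Y'01: "0 \<le> Y' w" "Y' w \<le> 1" for w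
  proof -
    show "0 \<le> Y' w" unfolding Y'_def by (intro cINF_greatest v01) auto
    show "Y' w \<le> 1" unfolding Y'_def using cINF_lower[OF bdd, of undefined] v01(2) by (rule order_trans) simp
  qed
  \<comment> \<open>By Fubini, since the uniform measure of {..p q} is p q.\<close>
  have B: "emeasure N {w\<in>space N. fst w \<in> C \<and> snd w \<le> p q (fst w)}
     = emeasure M (C \<inter> {\<omega>\<in>space M. Y \<omega> \<le> real_of_rat q})" if C: "C \<in> sets G" for C q
  proof -
    have CM: "C \<in> sets M" using C setsG by auto
    have pM: "p q \<in> borel_measurable M" using p by (rule measurable_from_subalg[OF G])
    have m: "{w\<in>space N. fst w \<in> C \<and> snd w \<le> p q (fst w)} \<in> sets N"
      using C by measurable
    have "emeasure N {w\<in>space N. fst w \<in> C \<and> snd w \<le> p q (fst w)}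
       = (\<integral>\<^sup>+\<omega>. emeasure uniform01 (Pair \<omega> -` {w\<in>space N. fst w \<in> C \<and> snd w \<le> p q (fst w)}) \<partial>M)"
      using m unfolding N_def by (rule U.emeasure_pair_measure_alt)
    also have "\<dots> = (\<integral>\<^sup>+\<omega>. ennreal (indicator C \<omega> * p q \<omega>) \<partial>M)"
    proof (rule nn_integral_cong)
      fix \<omega> assume "\<omega> \<in> space M"
      then have "Pair \<omega> -` {w\<in>space N. fst w \<in> C \<and> snd w \<le> p q (fst w)} = (if \<omega> \<in> C then {..p q \<omega>} else {})"
        by (auto simp: N_def space_pair_measure)
      then show "emeasure uniform01 (Pair \<omega> -` {w\<in>space N. fst w \<in> C \<and> snd w \<le> p q (fst w)})
         = ennreal (indicator C \<omega> * p q \<omega>)"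
        using p01[of q \<omega>] by (simp add: emeasure_uniform01_atMost divide_ennreal_def)
    qed
    also have "\<dots> = ennreal (LINT \<omega>:C|M. p q \<omega>)"
      unfolding set_lebesgue_integral_def using pM CM p01
      by (subst nn_integral_eq_integral) (auto intro!: integrable_const_bound[where B=1] mult_nonneg_nonneg simp: indicator_def)
    finally show ?thesis using pint[OF C] by (simp add: emeasure_eq_measure)
  qed
  \<comment> \<open>The event Y' < r is the increasing union of the events just computed, along rationals q that increase to r.\<close>
  have gen: "emeasure N {w\<in>space N. fst w \<in> C \<and> Y' w < r} = emeasure M (C \<inter> {\<omega>\<in>space M. Y \<omega> < r})"
    if C: "C \<in> sets G" for C r
  proof -
    consider "r \<le> 0" | "0 < r" "r \<le> 1" | "1 < r" by linarith
    then show ?thesis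
    proof cases
      case 1
      have "\<not> Y' w < r" "\<not> Y \<omega> < r" for w \<omega> using 1 Y'01(1)[of w] Y01[of \<omega>] by linarith+
      then show ?thesis by simp
    next
      case 3
      have "Y' w < r" "Y \<omega> < r" for w \<omega> using 3 Y'01(2)[of w] Y01[of \<omega>] by linarith+
      moreover have "C \<subseteq> space M" using C sets.sets_into_space spG by blast
      moreover from this have "{w\<in>space N. fst w \<in> C} = C \<times> UNIV"
        by (auto simp: N_def space_pair_measure)
      moreover have "C \<in> sets M" using C setsG by auto
      ultimately show ?thesis
        using U.emeasure_space_1
        by (simp add: N_def U.emeasure_pair_measure_Times Int_absorb2)
    next
      case 2
      obtain q :: "nat \<Rightarrow> rat" where qq: "mono q \<and> (\<forall>n. real_of_rat (q n) < r) \<and> (\<forall>s<r. \<exists>n. s < real_of_rat (q n))"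
        using rat_sequence_below[of r] by (rule exE)
      have q: "mono q" "\<And>n. real_of_rat (q n) < r" "\<And>s. s < r \<Longrightarrow> \<exists>n. s < real_of_rat (q n)"
        using qq by simp_all
      have qm: "real_of_rat (q m) \<le> real_of_rat (q n)" if "m \<le> n" for m n
        using monoD[OF q(1) that] by (simp add: of_rat_less_eq)
      define A where "A = (\<lambda>n. {w\<in>space N. fst w \<in> C \<and> snd w \<le> p (q n) (fst w)})"
      define D where "D = (\<lambda>n. C \<inter> {\<omega>\<in>space M. Y \<omega> \<le> real_of_rat (q n)})"
      have "(\<Union>n. A n) = {w\<in>space N. fst w \<in> C \<and> Y' w < r}"
      proof (intro set_eqI iffI)
        fix w assume "w \<in> (\<Union>n. A n)"
        then show "w \<in> {w\<in>space N. fst w \<in> C \<and> Y' w < r}"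
          using q(2) by (auto simp: A_def lessY'[OF 2])
      next
        fix w assume w: "w \<in> {w\<in>space N. fst w \<in> C \<and> Y' w < r}"
        then obtain s where s: "real_of_rat s < r" "snd w \<le> p s (fst w)" by (auto simp: lessY'[OF 2])
        obtain n where "real_of_rat s < real_of_rat (q n)" using q(3)[OF s(1)] by auto
        then have "snd w \<le> p (q n) (fst w)"
          using s(2) pmono[of s "q n" "fst w"] by (auto simp: of_rat_less)
        then show "w \<in> (\<Union>n. A n)" using w by (auto simp: A_def)
      qed
      moreover have "(\<Union>n. D n) = C \<inter> {\<omega>\<in>space M. Y \<omega> < r}"
      proof (intro set_eqI iffI)
        fix w assume "w \<in> (\<Union>n. D n)"
        then show "w \<in> C \<inter> {\<omega>\<in>space M. Y \<omega> < r}"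
          using q(2) by (auto simp: D_def intro: le_less_trans)
      next
        fix w assume w: "w \<in> C \<inter> {\<omega>\<in>space M. Y \<omega> < r}"
        then obtain n where "Y w < real_of_rat (q n)" using q(3)[of "Y w"] by auto
        then show "w \<in> (\<Union>n. D n)" using w by (auto simp: D_def intro!: exI[of _ n])
      qed
      moreover have "(SUP n. emeasure N (A n)) = emeasure N (\<Union>n. A n)"
      proof (rule SUP_emeasure_incseq)
        have "A n \<in> sets N" for n unfolding A_def using C by measurable
        then show "range A \<subseteq> sets N" by (rule image_subsetI)
        show "incseq A"
          unfolding A_def incseq_def using pmono monoD[OF q(1)] by (auto intro: order_trans)
      qed
      moreover have "(SUP n. emeasure M (D n)) = emeasure M (\<Union>n. D n)"
      proof (rule SUP_emeasure_incseq)
        show "range D \<subseteq> sets M" unfolding D_def using C setsG by auto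
        show "incseq D" unfolding D_def incseq_def using qm by (auto intro: order_trans)
      qed
      moreover have "emeasure N (A n) = emeasure M (D n)" for n
        unfolding A_def D_def by (rule B[OF C])
      ultimately show ?thesis by simp
    qed
  qed
  define E where "E = {C \<times> {..<r} | C (r::real). C \<in> sets G}"
  have setsE: "sets (G \<Otimes>\<^sub>M (borel :: real measure)) = sigma_sets (space G \<times> UNIV) E"
  proof -
    have "sets (G \<Otimes>\<^sub>M (borel :: real measure)) = sets (sigma (space G \<times> space (borel :: real measure))
      {a \<times> b |a b. a \<in> sets G \<and> b \<in> range lessThan})"
    proof (rule sets_pair_eq)
      show "countable {space G}" "countable (range (\<lambda>n. {..<real n}))" by auto
      show "sets (borel :: real measure) = sigma_sets (space borel) (range lessThan)"
        by (subst borel_Iio) (simp add: sets_measure_of)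
      show "\<Union> (range (\<lambda>n. {..<real n})) = space borel"
        using reals_Archimedean2 by auto
    qed (auto simp: sets.space_closed sets.sigma_sets_eq)
    also have "{a \<times> b |a b. a \<in> sets G \<and> b \<in> range (lessThan :: real \<Rightarrow> _)} = E" by (auto simp: E_def)
    also have "sets (sigma (space G \<times> space (borel :: real measure)) E) = sigma_sets (space G \<times> UNIV) E"
      unfolding E_def by (subst sets_measure_of) (auto dest: sets.sets_into_space)
    finally show ?thesis .
  qed
  have "distr N (G \<Otimes>\<^sub>M borel) (\<lambda>w. (fst w, Y' w)) = distr M (G \<Otimes>\<^sub>M borel) (\<lambda>\<omega>. (\<omega>, Y \<omega>))"
  proof (rule measure_eqI_generator_eq[where E=E and \<Omega>="space G \<times> UNIV" and A="\<lambda>n::nat. space G \<times> {..<real n}"])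
    show "Int_stable E"
    proof (rule Int_stableI)
      fix a b assume "a \<in> E" "b \<in> E"
      then obtain C r D s where "a = C \<times> {..<r}" "b = D \<times> {..<s}" "C \<in> sets G" "D \<in> sets G" by (auto simp: E_def)
      then have "a \<inter> b = (C \<inter> D) \<times> {..<min r s}" "C \<inter> D \<in> sets G" by auto
      then show "a \<inter> b \<in> E" by (auto simp: E_def)
    qed
    show "E \<subseteq> Pow (space G \<times> UNIV)" by (auto simp: E_def dest: sets.sets_into_space)
    fix X assume "X \<in> E"
    then obtain C r where X: "X = C \<times> {..<r}" "C \<in> sets G" by (auto simp: E_def)
    then have XG: "X \<in> sets (G \<Otimes>\<^sub>M borel)" by auto
    have "emeasure (distr N (G \<Otimes>\<^sub>M borel) (\<lambda>w. (fst w, Y' w))) X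
       = emeasure N {w\<in>space N. fst w \<in> C \<and> Y' w < r}"
      by (subst emeasure_distr[OF _ XG]) (auto intro!: arg_cong[where f="emeasure N"] simp: X)
    moreover have "emeasure (distr M (G \<Otimes>\<^sub>M borel) (\<lambda>\<omega>. (\<omega>, Y \<omega>))) X
       = emeasure M (C \<inter> {\<omega>\<in>space M. Y \<omega> < r})"
      by (subst emeasure_distr[OF _ XG]) (auto intro!: arg_cong[where f="emeasure M"] simp: X)
    ultimately show "emeasure (distr N (G \<Otimes>\<^sub>M borel) (\<lambda>w. (fst w, Y' w))) X
      = emeasure (distr M (G \<Otimes>\<^sub>M borel) (\<lambda>\<omega>. (\<omega>, Y \<omega>))) X"
      using gen[OF X(2)] by simp
  next
    show "range (\<lambda>n::nat. space G \<times> {..<real n}) \<subseteq> E" by (auto simp: E_def)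
    show "(\<Union>n. space G \<times> {..<real n}) = space G \<times> UNIV" using reals_Archimedean2 by auto
    interpret D: prob_space "distr N (G \<Otimes>\<^sub>M borel) (\<lambda>w. (fst w, Y' w))"
      by (rule MU.prob_space_distr[folded N_def]) measurable
    show "emeasure (distr N (G \<Otimes>\<^sub>M borel) (\<lambda>w. (fst w, Y' w))) (space G \<times> {..<real n}) \<noteq> \<infinity>" for n
      by simp
  qed (simp_all add: setsE)
  then show ?thesis using that[of Y'] Y' by (simp add: N_def)
qed

section \<open>Past and future of a Levy process\<close>

text \<open>
  For \<open>I = {0..t}\<close> this is the past of \<open>Z\<close> up to time \<open>t\<close>, without null sets; \<open>I = {0..}\<close> gives the
  \<open>\<sigma>\<close>-algebra of the whole process.
\<close>

definition natural_algebra :: "'w measure \<Rightarrow> (real \<Rightarrow> 'w \<Rightarrow> real) \<Rightarrow> real set \<Rightarrow> 'w measure" where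
  "natural_algebra M Z I = sigma (space M) {Z s -` A \<inter> space M | s A. s \<in> I \<and> A \<in> sets borel}"

lemma space_natural_algebra [simp]: "space (natural_algebra M Z I) = space M"
  unfolding natural_algebra_def by (rule space_measure_of) auto

lemma sets_natural_algebra:
  "sets (natural_algebra M Z I) = sigma_sets (space M) {Z s -` A \<inter> space M | s A. s \<in> I \<and> A \<in> sets borel}"
  unfolding natural_algebra_def by (rule sets_measure_of) auto

lemma measurable_natural_algebra: "s \<in> I \<Longrightarrow> Z s \<in> borel_measurable (natural_algebra M Z I)"
  by (rule measurableI) (auto simp: sets_natural_algebra intro!: sigma_sets.Basic)

lemma natural_algebra_least:
  assumes "space N = space M" "\<And>s. s \<in> I \<Longrightarrow> Z s \<in> borel_measurable N"
  shows "sets (natural_algebra M Z I) \<subseteq> sets N"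
proof -
  have "{Z s -` A \<inter> space M | s A. s \<in> I \<and> A \<in> sets borel} \<subseteq> sets N"
    using measurable_sets[OF assms(2)] assms(1) by auto
  from sets.sigma_sets_subset[OF this] show ?thesis
    by (simp add: sets_natural_algebra assms(1))
qed

lemma natural_algebra_mono: "I \<subseteq> J \<Longrightarrow> sets (natural_algebra M Z I) \<subseteq> sets (natural_algebra M Z J)"
  by (intro natural_algebra_least measurable_natural_algebra) auto

text \<open>
  The sets over which \<open>g\<close> integrates to zero form a Dynkin system.
\<close>

lemma (in prob_space) set_integral_zero_sigma_sets:
  fixes g :: "'a \<Rightarrow> real"
  assumes g: "integrable M g" and E: "E \<subseteq> events" "Int_stable E"
    and zero: "\<And>C. C \<in> E \<Longrightarrow> (LINT \<omega>:C|M. g \<omega>) = 0" and total: "(LINT \<omega>|M. g \<omega>) = 0"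
    and C: "C \<in> sigma_sets (space M) E"
  shows "(LINT \<omega>:C|M. g \<omega>) = 0"
proof -
  have ev: "A \<in> events" if "A \<in> sigma_sets (space M) E" for A
    using that sets.sigma_sets_subset[OF E(1)] by auto
  have si: "set_integrable M A g" if "A \<in> sigma_sets (space M) E" for A
    using integrable_mult_indicator[OF ev[OF that] g] by (simp add: set_integrable_def)
  have "E \<subseteq> Pow (space M)" using E(1) sets.sets_into_space by auto
  from E(2) this C show ?thesis
  proof (induction rule: sigma_sets_induct_disjoint)
    case (basic A) then show ?case by (rule zero)
  next
    case empty then show ?case by (simp add: set_lebesgue_integral_def)
  next
    case (compl A)
    have "(LINT \<omega>:(A \<union> (space M - A))|M. g \<omega>) = (LINT \<omega>:A|M. g \<omega>) + (LINT \<omega>:(space M - A)|M. g \<omega>)"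
      using compl(1) by (intro set_integral_Un si sigma_sets.Compl) auto
    moreover have "A \<union> (space M - A) = space M" using sets.sets_into_space[OF ev[OF compl(1)]] by auto
    ultimately show ?case using compl(2) total g by (simp add: set_integral_space)
  next
    case (union A)
    have m: "(\<Union>i. A i) \<in> sigma_sets (space M) E" using union(2) by (intro sigma_sets.Union) auto
    have "(LINT \<omega>:(\<Union>i. A i)|M. g \<omega>) = (\<Sum>i. LINT \<omega>:A i|M. g \<omega>)"
      using union(1,2) by (intro lebesgue_integral_countable_add si[OF m] ev) (auto simp: disjoint_family_on_def)
    then show ?case using union(3) by simp
  qed
qed

context levy_process
begin

lemma space_F: "0 \<le> t \<Longrightarrow> space (F t) = space M" and sets_F: "0 \<le> t \<Longrightarrow> sets (F t) \<subseteq> sets M"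
  using subalgebra_F[of t] by (auto simp: subalgebra_def)

lemma measurable_Z_F: "0 \<le> s \<Longrightarrow> s \<le> t \<Longrightarrow> Z s \<in> borel_measurable (F t)"
proof -
  assume s: "0 \<le> s" "s \<le> t"
  then have "Z s \<in> borel_measurable (F s)" using adapted_Z by (auto simp: adapted_def)
  then show ?thesis
    using s F_mono[OF s] space_F[of s] space_F[of t]
    by (auto intro: measurable_from_subalg[of "F t" "F s"] simp: subalgebra_def)
qed

lemma measurable_Z: "0 \<le> s \<Longrightarrow> Z s \<in> borel_measurable M"
  using measurable_Z_F[of s s] subalgebra_F[of s] by (auto intro: measurable_from_subalg)

lemma past_subset_F: "0 \<le> t \<Longrightarrow> I \<subseteq> {0..t} \<Longrightarrow> sets (natural_algebra M Z I) \<subseteq> sets (F t)"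
  by (intro natural_algebra_least measurable_Z_F) (auto simp: space_F)

lemma subalgebra_natural: "I \<subseteq> {0..} \<Longrightarrow> subalgebra M (natural_algebra M Z I)"
  unfolding subalgebra_def
  by (intro conjI natural_algebra_least measurable_Z space_natural_algebra) auto

lemma integral_mult_increment:
  fixes g :: "'w \<Rightarrow> real"
  assumes s: "0 \<le> s" "s \<le> t" and g: "g \<in> borel_measurable (F s)" "integrable M g" and H: "H \<in> sets borel"
  shows "(LINT \<omega>|M. g \<omega> * indicator H (Z t \<omega> - Z s \<omega>))
    = (LINT \<omega>|M. g \<omega>) * prob {\<omega>\<in>space M. Z t \<omega> - Z s \<omega> \<in> H}"
proof -
  define Y where "Y = (\<lambda>\<omega>. Z t \<omega> - Z s \<omega>)"
  have Y[measurable]: "Y \<in> borel_measurable M"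
    unfolding Y_def using measurable_Z s by (intro borel_measurable_diff) auto
  have [measurable]: "H \<in> sets borel" by (rule H)
  define R where "R = vimage_algebra (space M) Y (borel :: real measure)"
  have R: "sets R = {Y -` A \<inter> space M | A. A \<in> sets borel}" "space R = space M"
    unfolding R_def by (auto simp: sets_vimage_algebra2)
  have ind: "indep_set (sets R) (sets (F s))"
    using independent_increments[of "t - s" s] s by (simp add: R Y_def)
  have "(\<lambda>\<omega>. indicator H (Y \<omega>) :: real) \<in> borel_measurable R"
    unfolding R_def using H by (intro measurable_compose[OF measurable_vimage_algebra1]) auto
  note mY = this
  have sig: "sigma_sets (space M) {f -` A \<inter> space M |A. A \<in> sets borel} \<subseteq> sets N"
    if "f \<in> borel_measurable N" "space N = space M" for f :: "'w \<Rightarrow> real" and N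
    using measurable_sets[OF that(1)] unfolding that(2)[symmetric] by (intro sets.sigma_sets_subset) auto
  have "indep_var borel g borel (\<lambda>\<omega>. indicator H (Y \<omega>) :: real)"
    unfolding indep_var_eq
  proof (intro conjI indep_setI)
    show gM: "g \<in> borel_measurable M" using g by auto
    show "(\<lambda>\<omega>. indicator H (Y \<omega>) :: real) \<in> borel_measurable M" by measurable
    note A = sig[OF g(1) space_F[OF s(1)]] and B = sig[OF mY R(2)]
    show "sigma_sets (space M) {g -` A \<inter> space M |A. A \<in> sets borel} \<subseteq> events"
      using A sets_F[OF s(1)] by blast
    show "sigma_sets (space M) {(\<lambda>\<omega>. indicator H (Y \<omega>) :: real) -` A \<inter> space M |A. A \<in> sets borel} \<subseteq> events"
      using B indep_setD_ev1[OF ind] by blast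
    fix a b assume "a \<in> sigma_sets (space M) {g -` A \<inter> space M |A. A \<in> sets borel}"
      "b \<in> sigma_sets (space M) {(\<lambda>\<omega>. indicator H (Y \<omega>) :: real) -` A \<inter> space M |A. A \<in> sets borel}"
    then have "prob (b \<inter> a) = prob b * prob a" using A B by (intro indep_setD[OF ind]) blast+
    then show "prob (a \<inter> b) = prob a * prob b" by (simp add: Int_commute mult.commute)
  qed
  then have "(LINT \<omega>|M. g \<omega> * indicator H (Y \<omega>)) = (LINT \<omega>|M. g \<omega>) * (LINT \<omega>|M. indicator H (Y \<omega>))"
    using g(2) by (intro indep_var_lebesgue_integral) (auto intro!: integrable_const_bound[where B=1])
  also have "(LINT \<omega>|M. indicator H (Y \<omega>)) = (LINT \<omega>|M. indicator {\<omega>\<in>space M. Y \<omega> \<in> H} \<omega>)"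
    by (intro Bochner_Integration.integral_cong) (auto simp: indicator_def)
  also have "\<dots> = prob {\<omega>\<in>space M. Y \<omega> \<in> H}" by simp
  finally show ?thesis by (simp add: Y_def)
qed

text \<open>
  Adding one more time \<open>b\<close> to the observed times: \<open>Z b\<close> is determined by \<open>Z s\<close> and an increment that is
  independent of \<open>F s\<close>, hence of \<open>g\<close> and of all sets in \<open>W\<close>.
\<close>

lemma set_integral_zero_step:
  fixes g :: "'w \<Rightarrow> real"
  assumes s: "0 \<le> s" "s \<le> b" and W: "space W = space M" "sets W \<subseteq> sets (F s)" "Z s \<in> borel_measurable W"
    and g: "g \<in> borel_measurable (F s)" "integrable M g"
    and zero: "\<And>C. C \<in> sets W \<Longrightarrow> (LINT \<omega>:C|M. g \<omega>) = 0"
    and W': "\<And>u. u \<in> I \<Longrightarrow> Z u \<in> borel_measurable W"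
    and C: "C \<in> sets (natural_algebra M Z (insert b I))"
  shows "(LINT \<omega>:C|M. g \<omega>) = 0"
proof -
  define E where "E = {A \<inter> {\<omega>\<in>space M. Z b \<omega> - Z s \<omega> \<in> H} | A H. A \<in> sets W \<and> H \<in> sets borel}"
  define V where "V = sigma (space M) E"
  have inc: "(\<lambda>\<omega>. Z b \<omega> - Z s \<omega>) \<in> borel_measurable M"
    using measurable_Z s by (intro borel_measurable_diff) auto
  have WM: "sets W \<subseteq> sets M" using W sets_F[OF s(1)] by auto
  have EM: "E \<subseteq> sets M"
  proof
    fix X assume "X \<in> E"
    then obtain A H where X: "X = A \<inter> ((\<lambda>\<omega>. Z b \<omega> - Z s \<omega>) -` H \<inter> space M)" "A \<in> sets W" "H \<in> sets borel"
      unfolding E_def by (auto simp: vimage_def Int_def conj_commute)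
    then show "X \<in> sets M" using measurable_sets[OF inc, of H] WM by auto
  qed
  have V: "sets V = sigma_sets (space M) E" "space V = space M"
    unfolding V_def using EM sets.space_closed[of M] by (auto intro!: sets_measure_of space_measure_of)
  have WV: "sets W \<subseteq> sets V"
  proof
    fix A assume A: "A \<in> sets W"
    have eq: "A = A \<inter> {\<omega>\<in>space M. Z b \<omega> - Z s \<omega> \<in> UNIV}" using sets.sets_into_space[OF A] W(1) by auto
    have "A \<in> E" unfolding E_def by (intro CollectI exI conjI, rule eq) (auto simp: A)
    then show "A \<in> sets V" unfolding V by (rule sigma_sets.Basic)
  qed
  then have ZV: "Z u \<in> borel_measurable V" if "Z u \<in> borel_measurable W" for u
    using that W(1) V(2) by (auto intro!: measurable_from_subalg[of V W] simp: subalgebra_def)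
  have incV: "(\<lambda>\<omega>. Z b \<omega> - Z s \<omega>) \<in> borel_measurable V"
  proof (rule measurableI)
    fix H :: "real set" assume H: "H \<in> sets borel"
    have "(\<lambda>\<omega>. Z b \<omega> - Z s \<omega>) -` H \<inter> space V = space M \<inter> {\<omega>\<in>space M. Z b \<omega> - Z s \<omega> \<in> H}"
      using V(2) by auto
    moreover have "space M \<inter> {\<omega>\<in>space M. Z b \<omega> - Z s \<omega> \<in> H} \<in> E"
      unfolding E_def using H sets.top[of W] W(1) by auto
    ultimately show "(\<lambda>\<omega>. Z b \<omega> - Z s \<omega>) -` H \<inter> space V \<in> sets V"
      unfolding V by (auto intro: sigma_sets.Basic)
  qed simp
  have "(\<lambda>\<omega>. (Z b \<omega> - Z s \<omega>) + Z s \<omega>) \<in> borel_measurable V"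
    using incV ZV[OF W(3)] by (rule borel_measurable_add)
  then have Zb: "Z b \<in> borel_measurable V" by simp
  have "sets (natural_algebra M Z (insert b I)) \<subseteq> sets V"
  proof (rule natural_algebra_least[OF V(2)])
    fix u assume "u \<in> insert b I"
    then show "Z u \<in> borel_measurable V"
    proof
      assume "u = b" then show ?thesis using Zb by (simp only:)
    next
      assume "u \<in> I" then show ?thesis by (intro ZV W')
    qed
  qed
  then have C: "C \<in> sigma_sets (space M) E" using C V by auto
  show ?thesis
  proof (rule set_integral_zero_sigma_sets)
    show "integrable M g" "E \<subseteq> events" "C \<in> sigma_sets (space M) E" by fact+
    show "Int_stable E"
    proof (rule Int_stableI)
      fix x y assume "x \<in> E" "y \<in> E"
      then obtain A H B K where xy: "x = A \<inter> {\<omega>\<in>space M. Z b \<omega> - Z s \<omega> \<in> H}" "A \<in> sets W" "H \<in> sets borel"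
        "y = B \<inter> {\<omega>\<in>space M. Z b \<omega> - Z s \<omega> \<in> K}" "B \<in> sets W" "K \<in> sets borel" by (auto simp: E_def)
      have "x \<inter> y = (A \<inter> B) \<inter> {\<omega>\<in>space M. Z b \<omega> - Z s \<omega> \<in> H \<inter> K}" using xy by auto
      moreover have "A \<inter> B \<in> sets W" "H \<inter> K \<in> sets borel" using xy by auto
      ultimately show "x \<inter> y \<in> E" unfolding E_def by blast
    qed
    show "(LINT \<omega>|M. g \<omega>) = 0"
      using zero[OF sets.top] g(2) W(1) by (simp add: set_integral_space)
    fix X assume "X \<in> E"
    then obtain A H where X: "X = A \<inter> {\<omega>\<in>space M. Z b \<omega> - Z s \<omega> \<in> H}" "A \<in> sets W" "H \<in> sets borel"
      by (auto simp: E_def)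
    have AM: "A \<in> sets M" and AF: "A \<in> sets (F s)" using X(2) W(2) WM by auto
    have "(LINT \<omega>:X|M. g \<omega>) = (LINT \<omega>|M. (indicator A \<omega> * g \<omega>) * indicator H (Z b \<omega> - Z s \<omega>))"
      unfolding set_lebesgue_integral_def by (intro Bochner_Integration.integral_cong) (auto simp: X indicator_def)
    also have "\<dots> = (LINT \<omega>|M. indicator A \<omega> * g \<omega>) * prob {\<omega>\<in>space M. Z b \<omega> - Z s \<omega> \<in> H}"
      using s g X(3) AF integrable_mult_indicator[OF AM g(2)]
      by (intro integral_mult_increment borel_measurable_times borel_measurable_indicator) auto
    also have "(LINT \<omega>|M. indicator A \<omega> * g \<omega>) = 0"
      using zero[OF X(2)] by (simp add: set_lebesgue_integral_def)
    finally show "(LINT \<omega>:X|M. g \<omega>) = 0" by simp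
  qed
qed

text \<open>
  A variable known at time \<open>t\<close> that is uncorrelated with the past of \<open>Z\<close> is uncorrelated with
  all of \<open>Z\<close>. Independence is assumed for one increment at a time, so the later times are added
  one by one in increasing order; the \<open>\<sigma>\<close>-algebras of finitely many later times are directed and
  generate that of the whole process.
\<close>

lemma set_integral_zero_future:
  fixes g :: "'w \<Rightarrow> real"
  assumes t: "0 \<le> t" and g: "g \<in> borel_measurable (F t)" "integrable M g"
    and zero: "\<And>C. C \<in> sets (natural_algebra M Z {0..t}) \<Longrightarrow> (LINT \<omega>:C|M. g \<omega>) = 0"
    and C: "C \<in> sets (natural_algebra M Z {0..})"
  shows "(LINT \<omega>:C|M. g \<omega>) = 0"
proof -
  have fin: "\<forall>C\<in>sets (natural_algebra M Z ({0..t} \<union> J)). (LINT \<omega>:C|M. g \<omega>) = 0"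
    if "finite J" "J \<subseteq> {t..}" for J
    using that
  proof (induction J rule: finite_linorder_max_induct)
    case empty
    then show ?case using zero by auto
  next
    case (insert b J)
    define s where "s = Max (insert t J)"
    have s: "s \<in> insert t J" "\<And>j. j \<in> insert t J \<Longrightarrow> j \<le> s"
      unfolding s_def using insert.hyps(1) by (intro Max_in Max_ge; simp)+
    have sb: "0 \<le> s" "s \<le> b" "t \<le> s" using s insert t by auto (fastforce)+
    have sub: "{0..t} \<union> J \<subseteq> {0..s}" using s(2) insert.prems t sb by force
    have st: "s \<in> {0..t} \<union> J" using s(1) t by auto
    have gs: "g \<in> borel_measurable (F s)"
      using F_mono[OF t sb(3)] space_F sb t
      by (auto intro!: measurable_from_subalg[OF _ g(1)] simp: subalgebra_def)
    have IH: "\<And>C. C \<in> sets (natural_algebra M Z ({0..t} \<union> J)) \<Longrightarrow> (LINT \<omega>:C|M. g \<omega>) = 0"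
      using insert by auto
    have "(LINT \<omega>:C|M. g \<omega>) = 0" if "C \<in> sets (natural_algebra M Z (insert b ({0..t} \<union> J)))" for C
      by (rule set_integral_zero_step[OF sb(1,2) space_natural_algebra past_subset_F[OF sb(1) sub]
          measurable_natural_algebra[OF st] gs g(2) IH measurable_natural_algebra that])
    then show ?case by simp
  qed
  define E where "E = (\<Union>J\<in>{J. finite J \<and> J \<subseteq> {t..}}. sets (natural_algebra M Z ({0..t} \<union> J)))"
  have sub: "subalgebra M (natural_algebra M Z ({0..t} \<union> J))" if "J \<subseteq> {t..}" for J
    using that t by (intro subalgebra_natural) auto
  have EM: "E \<subseteq> events" using sub by (auto simp: E_def subalgebra_def)
  have "{Z s -` A \<inter> space M | s A. s \<in> {0..} \<and> A \<in> sets borel} \<subseteq> E"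
  proof
    fix X assume "X \<in> {Z s -` A \<inter> space M | s A. s \<in> {0..} \<and> A \<in> sets borel}"
    then obtain s A where X: "X = Z s -` A \<inter> space M" and "s \<in> {0..}" and A: "A \<in> sets borel" by blast
    then have J: "{s} \<inter> {t..} \<in> {J. finite J \<and> J \<subseteq> {t..}}" "s \<in> {0..t} \<union> ({s} \<inter> {t..})" by auto
    have "Z s -` A \<inter> space M \<in> sets (natural_algebra M Z ({0..t} \<union> ({s} \<inter> {t..})))"
      using measurable_sets[OF measurable_natural_algebra[OF J(2), of Z M] A] by simp
    then show "X \<in> E" using J(1) unfolding E_def X by blast
  qed
  from sigma_sets_mono'[OF this, of "space M"] have CE: "C \<in> sigma_sets (space M) E"
    using C unfolding sets_natural_algebra by blast
  show ?thesis
  proof (rule set_integral_zero_sigma_sets)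
    show "integrable M g" "E \<subseteq> events" "C \<in> sigma_sets (space M) E" by fact+
    show "Int_stable E"
    proof (rule Int_stableI)
      fix x y assume "x \<in> E" "y \<in> E"
      then obtain J K where JK: "finite J" "J \<subseteq> {t..}" "finite K" "K \<subseteq> {t..}"
        "x \<in> sets (natural_algebra M Z ({0..t} \<union> J))" "y \<in> sets (natural_algebra M Z ({0..t} \<union> K))"
        by (auto simp: E_def)
      have "x \<inter> y \<in> sets (natural_algebra M Z ({0..t} \<union> (J \<union> K)))"
        using natural_algebra_mono[of "{0..t} \<union> J" "{0..t} \<union> (J \<union> K)" M Z]
          natural_algebra_mono[of "{0..t} \<union> K" "{0..t} \<union> (J \<union> K)" M Z] JK by blast
      moreover have "J \<union> K \<in> {J. finite J \<and> J \<subseteq> {t..}}" using JK by auto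
      ultimately show "x \<inter> y \<in> E" unfolding E_def by blast
    qed
    show "(LINT \<omega>|M. g \<omega>) = 0"
      using zero[OF sets.top] g(2) by (simp add: set_integral_space)
    show "(LINT \<omega>:X|M. g \<omega>) = 0" if "X \<in> E" for X using that fin by (auto simp: E_def)
  qed
qed

text \<open>
  Given all of \<open>Z\<close>, an event known at time \<open>t\<close> has the same conditional probability as given the past
  of \<open>Z\<close> up to \<open>t\<close>. This makes the conditional copy below compatible with the filtration, and
  in the end yields adaptedness rather than mere measurability with respect to the whole process.
\<close>

lemma cond_prob_past:
  assumes t: "0 \<le> t" and A: "A \<in> sets (F t)"
  obtains f where "f \<in> borel_measurable (natural_algebra M Z {0..t})" "integrable M f"
    "\<And>C. C \<in> sets (natural_algebra M Z {0..}) \<Longrightarrow> (LINT \<omega>:C|M. f \<omega>) = prob (A \<inter> C)"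
proof -
  let ?P = "natural_algebra M Z {0..t}"
  have sub: "subalgebra M ?P" by (rule subalgebra_natural) auto
  interpret P: finite_measure_subalgebra M ?P by standard (rule sub)
  define f where "f = real_cond_exp M ?P (indicator A)"
  have AM: "A \<in> events" using A sets_F[OF t] by auto
  have iA: "integrable M (indicator A :: 'w \<Rightarrow> real)" using AM by (simp add: less_top[symmetric])
  have f: "f \<in> borel_measurable ?P" "integrable M f" unfolding f_def using iA by auto
  have fF: "f \<in> borel_measurable (F t)"
    using past_subset_F[OF t, of "{0..t}"] space_F[OF t]
    by (intro measurable_from_subalg[OF _ f(1)]) (auto simp: subalgebra_def)
  have si: "set_integrable M C f" "set_integrable M C (indicator A :: 'w \<Rightarrow> real)" if "C \<in> events" for C
    using integrable_mult_indicator[OF that f(2)] integrable_mult_indicator[OF that iA]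
    by (simp_all add: set_integrable_def)
  have AC: "(LINT \<omega>:C|M. indicator A \<omega>) = prob (A \<inter> C)" if "C \<in> events" for C
  proof -
    have "(LINT \<omega>:C|M. indicator A \<omega> :: real) = (LINT \<omega>|M. indicator (A \<inter> C) \<omega>)"
      unfolding set_lebesgue_integral_def by (intro Bochner_Integration.integral_cong) (auto simp: indicator_def)
    then show ?thesis using AM that by simp
  qed
  have "(LINT \<omega>:C|M. f \<omega>) = prob (A \<inter> C)" if C: "C \<in> sets (natural_algebra M Z {0..})" for C
  proof -
    have CM: "C \<in> events" using C subalgebra_natural[of "{0..}"] by (auto simp: subalgebra_def)
    have "(LINT \<omega>:C|M. f \<omega> - indicator A \<omega>) = 0"
    proof (rule set_integral_zero_future[OF t _ _ _ C])
      show "(\<lambda>\<omega>. f \<omega> - indicator A \<omega>) \<in> borel_measurable (F t)"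
        using fF A by (intro borel_measurable_diff borel_measurable_indicator)
      show "integrable M (\<lambda>\<omega>. f \<omega> - indicator A \<omega>)" using f iA by auto
      fix D assume D: "D \<in> sets ?P"
      then have DM: "D \<in> events" using sub by (auto simp: subalgebra_def)
      show "(LINT \<omega>:D|M. f \<omega> - indicator A \<omega>) = 0"
        using P.real_cond_exp_intA[OF iA D] si[OF DM] by (simp add: set_integral_diff f_def)
    qed
    then show ?thesis using si[OF CM] AC[OF CM] by (simp add: set_integral_diff)
  qed
  then show ?thesis using that f by blast
qed

end

section \<open>The Levy process on the space extended by a copy\<close>

lemma (in prob_space) AE_eq_if_same_set_integrals:
  fixes f g :: "'a \<Rightarrow> real"
  assumes G: "subalgebra M G" and f: "f \<in> borel_measurable G" "integrable M f"
    and g: "g \<in> borel_measurable G" "integrable M g"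
    and eq: "\<And>C. C \<in> sets G \<Longrightarrow> (LINT \<omega>:C|M. f \<omega>) = (LINT \<omega>:C|M. g \<omega>)"
  shows "AE \<omega> in M. f \<omega> = g \<omega>"
proof -
  interpret finite_measure_subalgebra M G by standard (rule G)
  have "AE \<omega> in M. real_cond_exp M G f \<omega> = g \<omega>" by (rule real_cond_exp_charact[OF eq f(2) g(2) g(1)])
  moreover have "AE \<omega> in M. real_cond_exp M G f \<omega> = f \<omega>" by (rule real_cond_exp_F_meas[OF f(2,1)])
  ultimately show ?thesis by eventually_elim simp
qed

text \<open>
  On the space extended by an independent uniform variable, \<open>Y'\<close> depends on \<open>Z\<close> and that variable
  only and has, jointly with the whole process \<open>Z\<close>, the law of \<open>Y\<close>.
\<close>

locale copied_variable = levy_process M F Z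
  for M :: "'w measure" and F :: "real \<Rightarrow> 'w measure" and Z :: "real \<Rightarrow> 'w \<Rightarrow> real" +
  fixes Y :: "'w \<Rightarrow> real" and Y' :: "'w \<times> real \<Rightarrow> real"
  assumes Y: "Y \<in> borel_measurable M"
    and Y': "Y' \<in> borel_measurable (natural_algebra M Z {0..} \<Otimes>\<^sub>M borel)"
    and same_law: "distr (M \<Otimes>\<^sub>M uniform01) (natural_algebra M Z {0..} \<Otimes>\<^sub>M borel) (\<lambda>w. (fst w, Y' w))
      = distr M (natural_algebra M Z {0..} \<Otimes>\<^sub>M borel) (\<lambda>\<omega>. (\<omega>, Y \<omega>))"
begin

definition N :: "('w \<times> real) measure" where "N = M \<Otimes>\<^sub>M uniform01"

text \<open>
  The enlarged filtration \<open>H\<close> reveals about \<open>Y'\<close> at time \<open>t\<close> what \<open>F t\<close> knows about \<open>Y\<close>: the event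
  \<open>Y' \<in> B\<close> is included exactly for those \<open>B\<close> for which \<open>Y \<in> B\<close> is known at time \<open>t\<close>.
\<close>

definition copy_generator :: "real \<Rightarrow> ('w \<times> real) set set" where
  "copy_generator t = {{w\<in>space N. fst w \<in> C \<and> Y' w \<in> B} | C B.
     C \<in> sets (F t) \<and> B \<in> sets borel \<and> Y -` B \<inter> space M \<in> sets (F t)}"

definition H :: "real \<Rightarrow> ('w \<times> real) measure" where
  "H t = sigma (space N) (copy_generator t)"

sublocale U: prob_space uniform01 by (rule prob_space_uniform01)
sublocale MU: pair_prob_space M uniform01 ..
sublocale N: prob_space N unfolding N_def by (rule MU.prob_space_axioms)

lemma space_N: "space N = space M \<times> UNIV" by (simp add: N_def space_pair_measure)

lemma fst_measurable: "fst \<in> measurable N M" by (simp add: N_def)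

lemma distr_fst: "distr N M fst = M" unfolding N_def by (rule U.distr_pair_fst)

lemma id_measurable: "(\<lambda>\<omega>. \<omega>) \<in> measurable M (natural_algebra M Z {0..})"
  using measurable_from_subalg[OF subalgebra_natural[of "{0..}"] measurable_ident] by (simp add: id_def)

lemma pair_measurable: "(\<lambda>w. (fst w, snd w)) \<in> measurable N (natural_algebra M Z {0..} \<Otimes>\<^sub>M borel)"
  unfolding N_def
  by (intro measurable_Pair measurable_compose[OF measurable_fst id_measurable])
    (auto intro: measurable_compose[OF measurable_snd])

lemma Y'_measurable: "Y' \<in> borel_measurable N"
  using measurable_compose[OF pair_measurable Y'] by simp

lemma copy_measurable: "(\<lambda>w. (fst w, Y' w)) \<in> measurable N (natural_algebra M Z {0..} \<Otimes>\<^sub>M borel)"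
  by (intro measurable_Pair Y'_measurable measurable_compose[OF fst_measurable id_measurable])

lemma original_measurable: "(\<lambda>\<omega>. (\<omega>, Y \<omega>)) \<in> measurable M (natural_algebra M Z {0..} \<Otimes>\<^sub>M borel)"
  by (intro measurable_Pair Y id_measurable)

lemma AE_fst:
  assumes "AE \<omega> in M. P \<omega>"
  shows "AE w in N. P (fst w)"
proof (rule AE_distrD[OF fst_measurable])
  show "AE \<omega> in distr N M fst. P \<omega>" unfolding distr_fst by (rule assms)
qed

text \<open>
  Almost sure relations between \<open>Z\<close> and \<open>Y\<close> carry over to \<open>Z\<close> and \<open>Y'\<close>.
\<close>

lemma AE_copy:
  assumes "Measurable.pred (natural_algebra M Z {0..} \<Otimes>\<^sub>M borel) P" and "AE \<omega> in M. P (\<omega>, Y \<omega>)"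
  shows "AE w in N. P (fst w, Y' w)"
proof -
  have m: "{p \<in> space (natural_algebra M Z {0..} \<Otimes>\<^sub>M borel). P p} \<in> sets (natural_algebra M Z {0..} \<Otimes>\<^sub>M borel)"
    using assms(1) by measurable
  have "AE p in distr M (natural_algebra M Z {0..} \<Otimes>\<^sub>M borel) (\<lambda>\<omega>. (\<omega>, Y \<omega>)). P p"
    using assms(2) by (subst AE_distr_iff[OF original_measurable m])
  then have "AE p in distr N (natural_algebra M Z {0..} \<Otimes>\<^sub>M borel) (\<lambda>w. (fst w, Y' w)). P p"
    unfolding N_def same_law .
  then show ?thesis by (subst (asm) AE_distr_iff[OF copy_measurable m])
qed

lemma event_measurable:
  assumes "C \<in> events" "B \<in> sets borel"
  shows "{w\<in>space N. fst w \<in> C \<and> Y' w \<in> B} \<in> sets N"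
proof -
  have "{w\<in>space N. fst w \<in> C \<and> Y' w \<in> B} = (fst -` C \<inter> space N) \<inter> (Y' -` B \<inter> space N)" by auto
  then show ?thesis
    using measurable_sets[OF fst_measurable assms(1)] measurable_sets[OF Y'_measurable assms(2)]
    by (simp only: sets.Int)
qed

text \<open>
  Conditionally on \<open>Z\<close>, the copy is independent of \<open>M\<close> and \<open>Y' \<in> B\<close> has the conditional probability
  of \<open>Y \<in> B\<close>. If \<open>Y \<in> B\<close> is known at time \<open>t\<close>, a version of it depends on the past of \<open>Z\<close> only.
\<close>

lemma copy_conditional_prob:
  assumes t: "0 \<le> t" and B: "B \<in> sets borel" and YB: "Y -` B \<inter> space M \<in> sets (F t)"
  obtains f where "f \<in> borel_measurable (natural_algebra M Z {0..t})" "integrable M f"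
    "\<And>C. C \<in> events \<Longrightarrow> N.prob {w\<in>space N. fst w \<in> C \<and> Y' w \<in> B} = (LINT \<omega>:C|M. f \<omega>)"
proof -
  let ?G = "natural_algebra M Z {0..}"
  have sub: "subalgebra M ?G" by (rule subalgebra_natural) auto
  obtain f where f: "f \<in> borel_measurable (natural_algebra M Z {0..t})" "integrable M f"
    and fint: "\<And>C. C \<in> sets ?G \<Longrightarrow> (LINT \<omega>:C|M. f \<omega>) = prob ((Y -` B \<inter> space M) \<inter> C)"
    using cond_prob_past[OF t YB] by blast
  have fG: "f \<in> borel_measurable ?G"
    using natural_algebra_mono[of "{0..t}" "{0..}" M Z]
    by (intro measurable_from_subalg[OF _ f(1)]) (auto simp: subalgebra_def)
  define m where "m = (\<lambda>\<omega>. measure uniform01 {u. Y' (\<omega>, u) \<in> B})"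
  have S: "{w\<in>space (?G \<Otimes>\<^sub>M uniform01). Y' w \<in> B} \<in> sets (?G \<Otimes>\<^sub>M uniform01)"
  proof -
    have "Y' \<in> borel_measurable (?G \<Otimes>\<^sub>M uniform01)"
      using Y' by (simp cong: measurable_cong_sets sets_pair_measure_cong)
    from measurable_sets[OF this B] show ?thesis by (simp add: vimage_def Int_def conj_commute)
  qed
  have mG: "m \<in> borel_measurable ?G"
  proof -
    have "(\<lambda>\<omega>. emeasure uniform01 (Pair \<omega> -` {w\<in>space (?G \<Otimes>\<^sub>M uniform01). Y' w \<in> B})) \<in> borel_measurable ?G"
      by (rule U.measurable_emeasure_Pair[OF S])
    then have "(\<lambda>\<omega>. enn2real (emeasure uniform01 (Pair \<omega> -` {w\<in>space (?G \<Otimes>\<^sub>M uniform01). Y' w \<in> B}))) \<in> borel_measurable ?G"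
      by measurable
    also have "?this \<longleftrightarrow> m \<in> borel_measurable ?G"
      by (intro measurable_cong) (auto simp: m_def measure_def space_pair_measure vimage_def)
    finally show ?thesis .
  qed
  have mM: "m \<in> borel_measurable M" using mG by (rule measurable_from_subalg[OF sub])
  have m01: "0 \<le> m \<omega>" "m \<omega> \<le> 1" for \<omega> by (auto simp: m_def)
  have mi: "integrable M m" using mM m01 by (intro integrable_const_bound[where B=1]) auto
  have joint: "N.prob {w\<in>space N. fst w \<in> C \<and> Y' w \<in> B} = (LINT \<omega>:C|M. m \<omega>)" if C: "C \<in> events" for C
  proof -
    have "emeasure N {w\<in>space N. fst w \<in> C \<and> Y' w \<in> B}
       = (\<integral>\<^sup>+\<omega>. emeasure uniform01 (Pair \<omega> -` {w\<in>space N. fst w \<in> C \<and> Y' w \<in> B}) \<partial>M)"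
      using event_measurable[OF C B] unfolding N_def by (rule U.emeasure_pair_measure_alt)
    also have "\<dots> = (\<integral>\<^sup>+\<omega>. ennreal (indicator C \<omega> * m \<omega>) \<partial>M)"
      by (intro nn_integral_cong) (auto simp: m_def space_N indicator_def vimage_def U.emeasure_eq_measure)
    also have "\<dots> = ennreal (LINT \<omega>:C|M. m \<omega>)"
      unfolding set_lebesgue_integral_def using mM C m01
      by (subst nn_integral_eq_integral) (auto intro!: integrable_const_bound[where B=1] simp: indicator_def)
    finally show ?thesis
      using m01 by (simp add: N.emeasure_eq_measure set_lebesgue_integral_def integral_nonneg)
  qed
  have "AE \<omega> in M. f \<omega> = m \<omega>"
  proof (rule AE_eq_if_same_set_integrals[OF sub fG f(2) mG mi])
    fix C assume C: "C \<in> sets ?G"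
    then have CM: "C \<in> events" using sub by (auto simp: subalgebra_def)
    have CB: "C \<times> B \<in> sets (?G \<Otimes>\<^sub>M borel)" using C B by auto
    have "(LINT \<omega>:C|M. m \<omega>) = N.prob {w\<in>space N. fst w \<in> C \<and> Y' w \<in> B}" using joint[OF CM] by simp
    also have "\<dots> = measure (distr N (?G \<Otimes>\<^sub>M borel) (\<lambda>w. (fst w, Y' w))) (C \<times> B)"
      by (subst measure_distr[OF copy_measurable CB]) (auto intro!: arg_cong[where f="measure N"])
    also have "\<dots> = measure (distr M (?G \<Otimes>\<^sub>M borel) (\<lambda>\<omega>. (\<omega>, Y \<omega>))) (C \<times> B)"
      using same_law by (simp add: N_def)
    also have "\<dots> = prob ((Y -` B \<inter> space M) \<inter> C)"
      by (subst measure_distr[OF original_measurable CB]) (auto intro!: arg_cong[where f="measure M"])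
    also have "\<dots> = (LINT \<omega>:C|M. f \<omega>)" by (rule fint[OF C, symmetric])
    finally show "(LINT \<omega>:C|M. f \<omega>) = (LINT \<omega>:C|M. m \<omega>)" by simp
  qed
  then have "(LINT \<omega>:C|M. m \<omega>) = (LINT \<omega>:C|M. f \<omega>)" if "C \<in> events" for C
    using that f(2) mM unfolding set_lebesgue_integral_def by (intro integral_cong_AE) auto
  then show ?thesis using that[OF f] joint by simp
qed

lemma space_H [simp]: "space (H t) = space N"
  unfolding H_def by (rule space_measure_of) (auto simp: copy_generator_def)

lemma sets_H: "sets (H t) = sigma_sets (space N) (copy_generator t)"
  unfolding H_def by (rule sets_measure_of) (auto simp: copy_generator_def)

lemma copy_generatorI:
  "C \<in> sets (F t) \<Longrightarrow> B \<in> sets borel \<Longrightarrow> Y -` B \<inter> space M \<in> sets (F t) \<Longrightarrow>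
    {w\<in>space N. fst w \<in> C \<and> Y' w \<in> B} \<in> copy_generator t"
  unfolding copy_generator_def by blast

lemma copy_generator_sets: "0 \<le> t \<Longrightarrow> copy_generator t \<subseteq> sets N"
  using sets_F[of t] event_measurable by (auto simp: copy_generator_def)

lemma filtered_H: "filtered_prob_space N H"
proof
  fix t :: real assume t: "0 \<le> t"
  show "subalgebra N (H t)"
    using sets.sigma_sets_subset[OF copy_generator_sets[OF t]] by (auto simp: subalgebra_def sets_H)
next
  fix s t :: real assume "0 \<le> s" "s \<le> t"
  then have "copy_generator s \<subseteq> copy_generator t"
    using F_mono[of s t] unfolding copy_generator_def by blast
  then show "sets (H s) \<subseteq> sets (H t)" unfolding sets_H by (rule sigma_sets_mono')
qed

lemma measurable_fst_H:
  fixes X :: "'w \<Rightarrow> real"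
  assumes "0 \<le> t" "X \<in> borel_measurable (F t)"
  shows "(\<lambda>w. X (fst w)) \<in> borel_measurable (H t)"
proof (rule measurableI)
  fix A :: "real set" assume A: "A \<in> sets borel"
  have "(\<lambda>w. X (fst w)) -` A \<inter> space (H t) = {w\<in>space N. fst w \<in> X -` A \<inter> space M \<and> Y' w \<in> UNIV}"
    by (auto simp: space_N)
  also have "\<dots> \<in> copy_generator t"
  proof -
    have "X -` A \<inter> space M \<in> sets (F t)" "Y -` UNIV \<inter> space M \<in> sets (F t)"
      using measurable_sets[OF assms(2) A] sets.top[of "F t"] space_F[OF assms(1)] by auto
    then show ?thesis by (intro copy_generatorI) auto
  qed
  finally show "(\<lambda>w. X (fst w)) -` A \<inter> space (H t) \<in> sets (H t)"
    unfolding sets_H by (rule sigma_sets.Basic)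
qed simp

lemma measurable_copy_H:
  fixes g :: "real \<Rightarrow> real"
  assumes t: "0 \<le> t" and g: "g \<in> borel_measurable borel" and gY: "(\<lambda>\<omega>. g (Y \<omega>)) \<in> borel_measurable (F t)"
  shows "(\<lambda>w. g (Y' w)) \<in> borel_measurable (H t)"
proof (rule measurableI)
  fix A :: "real set" assume A: "A \<in> sets borel"
  have "(\<lambda>w. g (Y' w)) -` A \<inter> space (H t) = {w\<in>space N. fst w \<in> space M \<and> Y' w \<in> g -` A}"
    by (auto simp: space_N)
  also have "\<dots> \<in> copy_generator t"
  proof -
    have "Y -` (g -` A) \<inter> space M \<in> sets (F t)" 
      using measurable_sets[OF gY A] space_F[OF t] by (simp add: vimage_def)
    moreover have "space M \<in> sets (F t)" using sets.top[of "F t"] space_F[OF t] by simp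
    moreover have "g -` A \<in> sets borel" using measurable_sets[OF g A] by simp
    ultimately show ?thesis by (intro copy_generatorI)
  qed
  finally show "(\<lambda>w. g (Y' w)) -` A \<inter> space (H t) \<in> sets (H t)"
    unfolding sets_H by (rule sigma_sets.Basic)
qed simp

lemma Int_stable_copy_generator: "Int_stable (copy_generator t)"
proof (rule Int_stableI)
  fix a b assume "a \<in> copy_generator t" "b \<in> copy_generator t"
  then obtain C B D E where ab: "a = {w\<in>space N. fst w \<in> C \<and> Y' w \<in> B}" "b = {w\<in>space N. fst w \<in> D \<and> Y' w \<in> E}"
    and s: "C \<in> sets (F t)" "B \<in> sets borel" "Y -` B \<inter> space M \<in> sets (F t)"
      "D \<in> sets (F t)" "E \<in> sets borel" "Y -` E \<inter> space M \<in> sets (F t)"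
    unfolding copy_generator_def by blast
  have "a \<inter> b = {w\<in>space N. fst w \<in> C \<inter> D \<and> Y' w \<in> B \<inter> E}" using ab by auto
  moreover have "Y -` (B \<inter> E) \<inter> space M = (Y -` B \<inter> space M) \<inter> (Y -` E \<inter> space M)" by auto
  then have "Y -` (B \<inter> E) \<inter> space M \<in> sets (F t)" using s by (simp only: sets.Int)
  ultimately show "a \<inter> b \<in> copy_generator t"
    using s by (simp only: copy_generatorI sets.Int)
qed

text \<open>
  The probability that an event \<open>C\<close> of \<open>F t\<close> occurs together with a generating event \<open>Y' \<in> B\<close> is the
  integral over \<open>C\<close> of a function of the past of \<open>Z\<close>. Intersecting \<open>C\<close> with an event about a later
  increment multiplies this integral by the probability of that event.
\<close>

lemma levy_process_copy: "levy_process N H (\<lambda>t w. Z t (fst w))"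
proof (intro levy_process.intro filtered_H levy_process_axioms.intro)
  show "adapted H (\<lambda>t w. Z t (fst w))"
    using measurable_fst_H[OF _ measurable_Z_F] by (auto simp: adapted_def)
  show "cadlag (\<lambda>t. Z t (fst w))" "Z 0 (fst w) = 0" if "w \<in> space N" for w
    using that cadlag_Z Z_zero by (auto simp: space_N)
  fix s t :: real assume st: "0 \<le> s" "0 \<le> t"
  have inc: "(\<lambda>\<omega>. Z u \<omega> - Z v \<omega>) \<in> borel_measurable M" if "0 \<le> u" "0 \<le> v" for u v
    using that measurable_Z by (intro borel_measurable_diff) auto
  have d: "distr N borel (\<lambda>w. X (fst w)) = distr M borel X" if "X \<in> borel_measurable M" for X
  proof -
    have "distr (distr N M fst) borel X = distr N borel (\<lambda>w. X (fst w))"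
      using that fst_measurable by (simp add: distr_distr comp_def)
    then show ?thesis by (simp add: distr_fst)
  qed
  show "distr N borel (\<lambda>w. Z (t + s) (fst w) - Z t (fst w)) = distr N borel (\<lambda>w. Z s (fst w) - Z 0 (fst w))"
    using stationary_increments[OF st] d[OF inc[of "t + s" t]] d[OF inc[of s 0]] st by simp
  define R where "R = {(\<lambda>w. Z (t + s) (fst w) - Z t (fst w)) -` A \<inter> space N |A. A \<in> sets (borel :: real measure)}"
  have incN: "(\<lambda>w. Z (t + s) (fst w) - Z t (fst w)) \<in> borel_measurable N"
    using measurable_compose[OF fst_measurable inc[of "t + s" t]] st by simp
  have RN: "R \<subseteq> N.events" unfolding R_def using measurable_sets[OF incN] by blast
  have "N.indep_set R (copy_generator t)"
  proof (rule N.indep_setI[OF RN copy_generator_sets[OF st(2)]])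
    fix a b assume "a \<in> R" "b \<in> copy_generator t"
    then obtain A C B where a: "a = (\<lambda>w. Z (t + s) (fst w) - Z t (fst w)) -` A \<inter> space N" "A \<in> sets borel"
      and b: "b = {w\<in>space N. fst w \<in> C \<and> Y' w \<in> B}" "C \<in> sets (F t)" "B \<in> sets borel" "Y -` B \<inter> space M \<in> sets (F t)"
      unfolding R_def copy_generator_def by blast
    obtain f where f: "f \<in> borel_measurable (natural_algebra M Z {0..t})" "integrable M f"
      and prob: "\<And>C. C \<in> events \<Longrightarrow> N.prob {w\<in>space N. fst w \<in> C \<and> Y' w \<in> B} = (LINT \<omega>:C|M. f \<omega>)"
      using copy_conditional_prob[OF st(2) b(3,4)] by blast
    have fF: "f \<in> borel_measurable (F t)"
      using past_subset_F[OF st(2), of "{0..t}"] space_F[OF st(2)]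
      by (intro measurable_from_subalg[OF _ f(1)]) (auto simp: subalgebra_def)
    define D where "D = {\<omega>\<in>space M. Z (t + s) \<omega> - Z t \<omega> \<in> A}"
    have D: "D \<in> events"
      using measurable_sets[OF inc[of "t + s" t] a(2)] st by (simp add: D_def vimage_def Int_def conj_commute)
    have CM: "C \<in> events" using b(2) sets_F[OF st(2)] by auto
    have pa: "N.prob a = prob D"
    proof -
      have "prob D = measure (distr N M fst) D" by (simp add: distr_fst)
      also have "\<dots> = N.prob (fst -` D \<inter> space N)" by (rule measure_distr[OF fst_measurable D])
      also have "fst -` D \<inter> space N = a" by (auto simp: D_def a space_N)
      finally show ?thesis by simp
    qed
    have "a \<inter> b = {w\<in>space N. fst w \<in> C \<inter> D \<and> Y' w \<in> B}" by (auto simp: a b D_def space_N)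
    then have "N.prob (a \<inter> b) = (LINT \<omega>:C \<inter> D|M. f \<omega>)" using prob[OF sets.Int[OF CM D]] by simp
    also have "\<dots> = (LINT \<omega>|M. (indicator C \<omega> * f \<omega>) * indicator A (Z (t + s) \<omega> - Z t \<omega>))"
      unfolding set_lebesgue_integral_def by (intro Bochner_Integration.integral_cong) (auto simp: D_def indicator_def)
    also have "\<dots> = (LINT \<omega>|M. indicator C \<omega> * f \<omega>) * prob D"
      unfolding D_def using st fF b(2) a(2) integrable_mult_indicator[OF CM f(2)]
      by (intro integral_mult_increment borel_measurable_times borel_measurable_indicator) auto
    also have "(LINT \<omega>|M. indicator C \<omega> * f \<omega>) = N.prob b"
      using prob[OF CM] by (simp add: b set_lebesgue_integral_def)
    finally show "N.prob (a \<inter> b) = N.prob a * N.prob b" by (simp add: pa)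
  qed
  then have "N.indep_sets (case_bool R (copy_generator t)) UNIV" by (simp add: N.indep_set_def)
  moreover have "Int_stable R"
  proof (rule Int_stableI)
    fix a b assume "a \<in> R" "b \<in> R"
    then obtain A B where "A \<in> sets borel" "B \<in> sets borel"
      "a = (\<lambda>w. Z (t + s) (fst w) - Z t (fst w)) -` A \<inter> space N"
      "b = (\<lambda>w. Z (t + s) (fst w) - Z t (fst w)) -` B \<inter> space N" unfolding R_def by blast
    then have "A \<inter> B \<in> sets borel" "a \<inter> b = (\<lambda>w. Z (t + s) (fst w) - Z t (fst w)) -` (A \<inter> B) \<inter> space N" by auto
    then show "a \<inter> b \<in> R" unfolding R_def by blast
  qed
  ultimately have "N.indep_sets (\<lambda>i. sigma_sets (space N) (case_bool R (copy_generator t) i)) UNIV"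
    by (intro N.indep_sets_sigma) (auto simp: Int_stable_copy_generator split: bool.split)
  then have "N.indep_sets (case_bool R (sets (H t))) UNIV"
    by (rule N.indep_sets_mono_sets) (auto simp: sets_H split: bool.splits)
  then show "N.indep_set {(\<lambda>w. Z (t + s) (fst w) - Z t (fst w)) -` A \<inter> space N |A. A \<in> sets borel} (sets (H t))"
    by (simp add: N.indep_set_def R_def)
qed

end

section \<open>Recovering the drift from its values on grids\<close>

text \<open>
  The index \<open>k\<close> of the last grid time \<open>k / (n + 1)\<close> not after \<open>t\<close>.
\<close>

definition grid :: "nat \<Rightarrow> real \<Rightarrow> nat" where
  "grid n t = nat \<lfloor>real (Suc n) * t\<rfloor>"

lemma grid_bounds:
  assumes "0 \<le> t"
  shows "real (grid n t) / real (Suc n) \<le> t" "t < real (Suc (grid n t)) / real (Suc n)"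
    "t - 1 / real (Suc n) \<le> real (grid n t) / real (Suc n)"
    "real (Suc (grid n t)) / real (Suc n) \<le> t + 1 / real (Suc n)"
proof -
  have "0 \<le> \<lfloor>real (Suc n) * t\<rfloor>" using assms by simp
  then have g: "real (grid n t) = of_int \<lfloor>real (Suc n) * t\<rfloor>" unfolding grid_def by (rule of_nat_nat)
  then have 1: "real (grid n t) \<le> real (Suc n) * t" and 2: "real (Suc n) * t < real (grid n t) + 1" by linarith+
  have s: "real (Suc (grid n t)) = real (grid n t) + 1" by simp
  have pos: "0 < real (Suc n)" by simp
  show "real (grid n t) / real (Suc n) \<le> t" using 1 pos by (simp only: pos_divide_le_eq mult.commute)
  then show "real (Suc (grid n t)) / real (Suc n) \<le> t + 1 / real (Suc n)"
    unfolding s add_divide_distrib by simp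
  show "t < real (Suc (grid n t)) / real (Suc n)" using 2 pos unfolding s by (simp only: pos_less_divide_eq mult.commute)
  then show "t - 1 / real (Suc n) \<le> real (grid n t) / real (Suc n)"
    unfolding s add_divide_distrib by simp
qed

lemma inverse_Suc_tendsto: "(\<lambda>n. 1 / real (Suc n)) \<longlonglongrightarrow> 0"
  by (rule LIMSEQ_Suc, rule lim_const_over_n)

lemma grid_tendsto_below:
  assumes t: "0 \<le> t"
  shows "(\<lambda>n. real (grid n t) / real (Suc n)) \<longlonglongrightarrow> t"
proof (rule real_tendsto_sandwich)
  show "(\<lambda>n. t - 1 / real (Suc n)) \<longlonglongrightarrow> t"
    using tendsto_diff[OF tendsto_const[of t] inverse_Suc_tendsto] by simp
  show "\<forall>\<^sub>F n in sequentially. t - 1 / real (Suc n) \<le> real (grid n t) / real (Suc n)"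
    using grid_bounds(3)[OF t] by (rule always_eventually[OF allI])
  show "\<forall>\<^sub>F n in sequentially. real (grid n t) / real (Suc n) \<le> t"
    using grid_bounds(1)[OF t] by (rule always_eventually[OF allI])
qed (rule tendsto_const)

lemma grid_tendsto_above:
  assumes t: "0 \<le> t"
  shows "filterlim (\<lambda>n. real (Suc (grid n t)) / real (Suc n)) (at_right t) sequentially"
proof (rule filterlim_at_withinI)
  show "(\<lambda>n. real (Suc (grid n t)) / real (Suc n)) \<longlonglongrightarrow> t"
  proof (rule real_tendsto_sandwich[where f="\<lambda>_. t"])
    show "(\<lambda>n. t + 1 / real (Suc n)) \<longlonglongrightarrow> t"
      using tendsto_add[OF tendsto_const[of t] inverse_Suc_tendsto] by simp
    show "\<forall>\<^sub>F n in sequentially. t \<le> real (Suc (grid n t)) / real (Suc n)"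
      using less_imp_le[OF grid_bounds(2)[OF t]] by (rule always_eventually[OF allI])
    show "\<forall>\<^sub>F n in sequentially. real (Suc (grid n t)) / real (Suc n) \<le> t + 1 / real (Suc n)"
      using grid_bounds(4)[OF t] by (rule always_eventually[OF allI])
  qed (rule tendsto_const)
  have "real (Suc (grid n t)) / real (Suc n) \<in> {t<..} - {t}" for n
    using grid_bounds(2)[OF t, of n] by (simp only: Diff_iff greaterThan_iff singleton_iff) (metis less_irrefl)
  then show "\<forall>\<^sub>F n in sequentially. real (Suc (grid n t)) / real (Suc n) \<in> {t<..} - {t}"
    by (intro always_eventually allI)
qed

lemma measurable_grid [measurable]: "grid n \<in> measurable borel (count_space UNIV)"
  unfolding grid_def by measurable

text \<open>
  \<open>d (n, k) y\<close> is the drift at time \<open>k / (n + 1)\<close> as decoded from \<open>y\<close>. The drift at time \<open>t\<close> is the limit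
  along grid times before \<open>t\<close>, so that it is known at time \<open>t\<close>. As a limit of step functions in
  \<open>t\<close> it is jointly measurable in \<open>t\<close> and \<open>y\<close>.
\<close>

definition grid_lim :: "(nat \<times> nat \<Rightarrow> real \<Rightarrow> real) \<Rightarrow> real \<Rightarrow> real \<Rightarrow> real" where
  "grid_lim d t y = lim (\<lambda>n. d (n, grid n t) y)"

lemma grid_lim_eq:
  assumes t: "0 \<le> t" and J: "continuous_on {0..t} J"
    and d: "\<And>n k. d (n, k) y = J (real k / real (Suc n))"
  shows "grid_lim d t y = J t"
proof -
  have "((\<lambda>n. J (real (grid n t) / real (Suc n))) \<longlongrightarrow> J t) sequentially"
  proof (rule continuous_on_tendsto_compose[OF J grid_tendsto_below[OF t]])
    have "0 \<le> real (grid n t) / real (Suc n)" for n by simp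
    then show "\<forall>\<^sub>F n in sequentially. real (grid n t) / real (Suc n) \<in> {0..t}"
      using grid_bounds(1)[OF t] by (intro always_eventually allI) (simp only: atLeastAtMost_iff)
  qed (use t in simp)
  then show ?thesis unfolding grid_lim_def d by (rule limI)
qed

text \<open>
  The equation in terms of the decoded drift, required at the grid times only: this is a
  countable set of conditions, hence a measurable one, and continuity of the integral restores the
  equation at all times.
\<close>

definition drift_path :: "(real \<Rightarrow> real) \<Rightarrow> real \<Rightarrow> (nat \<times> nat \<Rightarrow> real \<Rightarrow> real) \<Rightarrow> (real \<Rightarrow> real) \<Rightarrow> real \<Rightarrow> bool" where
  "drift_path a x d z y \<longleftrightarrow>
    (\<forall>n::nat. set_integrable lborel {0..real n} (\<lambda>s. a (x + grid_lim d s y + z s))) \<and>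
    (\<forall>n k. d (n, k) y = (LINT s:{0..real k / real (Suc n)}|lborel. a (x + grid_lim d s y + z s)))"

lemma drift_path_imp_solves_path:
  assumes "drift_path a x d z y"
  shows "solves_path a x z (\<lambda>t. x + grid_lim d t y + z t)"
proof -
  let ?c = "\<lambda>s. a (x + grid_lim d s y + z s)"
  have int: "set_integrable lborel {0..T} ?c" for T
  proof -
    obtain n :: nat where "T \<le> real n" using real_arch_simple by blast
    moreover have "set_integrable lborel {0..real n} ?c" using assms by (simp add: drift_path_def)
    ultimately show ?thesis by (rule_tac set_integrable_subset) auto
  qed
  have "grid_lim d t y = (LINT s:{0..t}|lborel. ?c s)" if "0 \<le> t" for t
    using that assms continuous_on_set_integral[OF int]
    by (intro grid_lim_eq) (auto simp: drift_path_def)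
  then show ?thesis using int by (simp add: solves_path_def)
qed

lemma solves_path_imp_drift_path:
  assumes f: "solves_path a x z f"
    and d: "\<And>n k. d (n, k) y = f (real k / real (Suc n)) - x - z (real k / real (Suc n))"
  shows "\<And>t. 0 \<le> t \<Longrightarrow> f t = x + grid_lim d t y + z t" and "drift_path a x d z y"
proof -
  let ?J = "\<lambda>t. LINT s:{0..t}|lborel. a (f s)"
  have int: "set_integrable lborel {0..real n} (\<lambda>s. a (f s))" for n
    using f set_integrable_subset[of lborel "{0..1}" "\<lambda>s. a (f s)" "{0..0}"]
    by (cases "n = 0") (auto simp: solves_path_def)
  have eq: "f t = x + ?J t + z t" if "0 \<le> t" for t using f that by (simp add: solves_path_def)
  have dJ: "d (n, k) y = ?J (real k / real (Suc n))" for n k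
    using d[of n k] eq[of "real k / real (Suc n)"] by simp
  have lim: "grid_lim d t y = ?J t" if t: "0 \<le> t" for t
  proof -
    obtain n :: nat where "t \<le> real n" using real_arch_simple by blast
    then have "set_integrable lborel {0..t} (\<lambda>s. a (f s))"
      by (rule_tac set_integrable_subset[OF int[of n]]) auto
    from continuous_on_set_integral[OF this] show ?thesis
      by (rule grid_lim_eq[where J="?J" and d=d, OF t _ dJ])
  qed
  show ft: "f t = x + grid_lim d t y + z t" if "0 \<le> t" for t using eq[OF that] lim[OF that] by simp
  have ind: "indicator {0..T} s *\<^sub>R a (f s) = indicator {0..T} s *\<^sub>R a (x + grid_lim d s y + z s)" for s T :: real
    using ft[of s] by (auto simp: indicator_def)
  show "drift_path a x d z y"
    using int dJ unfolding drift_path_def set_integrable_def set_lebesgue_integral_def ind by blast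
qed

text \<open>
  Values of \<open>Z\<close> at varying times are limits of values at grid times from the right, by right
  continuity; this gives joint measurability in time and sample point, and the integrals over time are
  measurable by Fubini.
\<close>

lemma (in levy_process) pred_drift_path:
  assumes a[measurable]: "a \<in> borel_measurable borel" and d: "\<And>i. d i \<in> borel_measurable borel"
  shows "Measurable.pred (natural_algebra M Z {0..} \<Otimes>\<^sub>M borel)
    (\<lambda>p. drift_path a x d (\<lambda>s. Z s (fst p)) (snd p))"
proof -
  let ?G = "natural_algebra M Z {0..} \<Otimes>\<^sub>M (borel :: real measure)"
  define zr where "zr = (\<lambda>s \<omega>. lim (\<lambda>n. Z (real (Suc (grid n s)) / real (Suc n)) \<omega>))"
  have zr: "zr s \<omega> = Z s \<omega>" if "0 \<le> s" "\<omega> \<in> space M" for s \<omega>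
  proof -
    have "((\<lambda>t. Z t \<omega>) \<longlongrightarrow> Z s \<omega>) (at_right s)"
      using cadlag_Z[OF that(2)] that(1) by (auto simp: cadlag_def continuous_within)
    from filterlim_compose[OF this grid_tendsto_above[OF that(1)]] show ?thesis
      unfolding zr_def by (rule limI)
  qed
  define h where "h = (\<lambda>p s. a (x + grid_lim d s (snd p) + zr s (fst p)))"
  have [measurable]: "(\<lambda>q. d (n, grid n (snd q)) (snd (fst q))) \<in> borel_measurable (?G \<Otimes>\<^sub>M lborel)" for n
    by (rule measurable_compose_countable[where f="\<lambda>k q. d (n, k) (snd (fst q))" and g="\<lambda>q. grid n (snd q)"])
      (auto intro!: measurable_compose[OF _ d] measurable_compose[OF _ measurable_grid])
  have Zm: "Z c \<in> borel_measurable (natural_algebra M Z {0..})" if "0 \<le> c" for c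
    using that by (intro measurable_natural_algebra) simp
  have [measurable]: "(\<lambda>q. Z (real (Suc (grid n (snd q))) / real (Suc n)) (fst (fst q))) \<in> borel_measurable (?G \<Otimes>\<^sub>M lborel)" for n
    by (rule measurable_compose_countable[where f="\<lambda>k q. Z (real (Suc k) / real (Suc n)) (fst (fst q))" and g="\<lambda>q. grid n (snd q)"])
      (auto intro!: measurable_compose[OF _ Zm] measurable_compose[OF _ measurable_grid])
  have h[measurable]: "(\<lambda>q. h (fst q) (snd q)) \<in> borel_measurable (?G \<Otimes>\<^sub>M lborel)"
    unfolding h_def grid_lim_def zr_def by measurable
  have [measurable]: "case_prod (\<lambda>p s. indicator {0..T} s *\<^sub>R h p s) \<in> borel_measurable (?G \<Otimes>\<^sub>M lborel)" for T :: real
    unfolding case_prod_unfold by measurable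
  have [measurable]: "d i \<in> borel_measurable borel" for i by (rule d)
  have ind: "indicator {0..T} s *\<^sub>R a (x + grid_lim d s (snd p) + Z s (fst p)) = indicator {0..T} s *\<^sub>R h p s"
    if "p \<in> space ?G" for p and s T :: real
    using that zr[of s "fst p"] by (auto simp: indicator_def h_def space_pair_measure)
  have "drift_path a x d (\<lambda>s. Z s (fst p)) (snd p) \<longleftrightarrow>
     (\<forall>n::nat. integrable lborel (\<lambda>s. indicator {0..real n} s *\<^sub>R h p s)) \<and>
     (\<forall>n k. d (n, k) (snd p) = (LINT s|lborel. indicator {0..real k / real (Suc n)} s *\<^sub>R h p s))"
    if "p \<in> space ?G" for p
    unfolding drift_path_def set_integrable_def set_lebesgue_integral_def ind[OF that] ..
  moreover have "Measurable.pred ?G (\<lambda>p. 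
     (\<forall>n::nat. integrable lborel (\<lambda>s. indicator {0..real n} s *\<^sub>R h p s)) \<and>
     (\<forall>n k. d (n, k) (snd p) = (LINT s|lborel. indicator {0..real k / real (Suc n)} s *\<^sub>R h p s)))"
    by measurable
  ultimately show ?thesis by (simp cong: measurable_cong)
qed

section \<open>Strong solutions\<close>

lemma space_completed_natural_filtration [simp]: "space (completed_natural_filtration M Z t) = space M"
  and sets_completed_natural_filtration: "sets (completed_natural_filtration M Z t) = sigma_sets (space M)
    ({Z s -` A \<inter> space M | s A. 0 \<le> s \<and> s \<le> t \<and> A \<in> sets borel} \<union> null_sets (completion M))"
proof -
  have "{Z s -` A \<inter> space M | s A. 0 \<le> s \<and> s \<le> t \<and> A \<in> sets borel} \<union> null_sets (completion M) \<subseteq> Pow (space M)"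
    using sets.sets_into_space[of _ "completion M"] by auto
  then show "space (completed_natural_filtration M Z t) = space M"
    "sets (completed_natural_filtration M Z t) = sigma_sets (space M)
    ({Z s -` A \<inter> space M | s A. 0 \<le> s \<and> s \<le> t \<and> A \<in> sets borel} \<union> null_sets (completion M))"
    unfolding completed_natural_filtration_def by (auto intro: space_measure_of sets_measure_of)
qed

lemma natural_subset_completed: "sets (natural_algebra M Z {0..t}) \<subseteq> sets (completed_natural_filtration M Z t)"
  unfolding sets_natural_algebra sets_completed_natural_filtration by (intro sigma_sets_mono') auto

text \<open>
  Every subset of a null set belongs to the completed filtration.
\<close>

lemma completed_natural_filtration_AE_eq:
  assumes A: "A \<in> sets (completed_natural_filtration M Z t)" and B: "B \<subseteq> space M"
    and ae: "AE \<omega> in M. \<omega> \<in> A \<longleftrightarrow> \<omega> \<in> B"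
  shows "B \<in> sets (completed_natural_filtration M Z t)"
proof -
  obtain N0 where N0: "N0 \<in> null_sets M" "{\<omega>\<in>space M. \<not> (\<omega> \<in> A \<longleftrightarrow> \<omega> \<in> B)} \<subseteq> N0"
    using ae unfolding eventually_ae_filter by blast
  have "N0 \<in> null_sets (completion M)" "B \<inter> N0 \<in> null_sets (completion M)"
    using N0(1) null_sets_completion_subset[of "B \<inter> N0" N0 M] by (auto intro: null_sets_completionI)
  then have "N0 \<in> sets (completed_natural_filtration M Z t)" "B \<inter> N0 \<in> sets (completed_natural_filtration M Z t)"
    unfolding sets_completed_natural_filtration by (auto intro!: sigma_sets.Basic)
  moreover have "B = (A - N0) \<union> (B \<inter> N0)"
    using N0(2) B sets.sets_into_space[OF A] by auto
  ultimately show ?thesis using A by (metis sets.Diff sets.Un)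
qed

text \<open>
  The drift \<open>\<xi> - x - Z\<close> on all grids is coded by a real variable \<open>Y\<close>, of which a copy \<open>Y'\<close> is taken. The
  process rebuilt from \<open>Y'\<close> and \<open>Z\<close> solves the equation on the extended space, because the equation is an
  almost sure relation between the code and \<open>Z\<close>. By pathwise uniqueness it coincides with \<open>\<xi>\<close>. So an
  event about the drift at time \<open>t\<close> agrees almost surely with the same event about the copy; its
  conditional probability given the past of \<open>Z\<close> is then its own indicator, which puts the event into the
  completed past of \<open>Z\<close>.
\<close>

theorem weak_uniqueness_implies_strong_solution:
  fixes M :: "'w measure"
  assumes a: "a \<in> borel_measurable borel" and uniq: "weak_solution_unique a x L"
    and ws: "weak_solution a x L M F Z \<xi>"
  shows "strong_solution a x M F Z \<xi>"
proof -
  interpret levy_process M F Z using ws by (simp add: weak_solution_def)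
  have ad: "adapted F \<xi>" and solves: "AE \<omega> in M. solves_path a x (\<lambda>t. Z t \<omega>) (\<lambda>t. \<xi> t \<omega>)"
    and law: "process_law M Z = L"
    using ws by (auto simp: weak_solution_def sde_solution_iff_solves_path)
  define X where "X = (\<lambda>(n::nat, k::nat) \<omega>. \<xi> (real k / real (Suc n)) \<omega> - x - Z (real k / real (Suc n)) \<omega>)"
  have \<xi>F: "\<xi> s \<in> borel_measurable (F t)" if "0 \<le> s" "s \<le> t" for s t
    using ad that F_mono[OF that] space_F[of s] space_F[of t]
    by (intro measurable_from_subalg[of "F t" "F s"]) (auto simp: subalgebra_def adapted_def)
  have XF: "X (n, k) \<in> borel_measurable (F t)" if "real k / real (Suc n) \<le> t" for n k t
    unfolding X_def prod.case using that
    by (intro borel_measurable_diff \<xi>F measurable_Z_F borel_measurable_const) auto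
  have XM: "X i \<in> borel_measurable M" for i
  proof -
    obtain n k where i: "i = (n, k)" by (cases i)
    have t: "0 \<le> real k / real (Suc n)" by simp
    show ?thesis unfolding i by (rule measurable_from_subalg[OF subalgebra_F[OF t] XF]) simp
  qed
  obtain Y :: "'w \<Rightarrow> real" and d :: "nat \<times> nat \<Rightarrow> real \<Rightarrow> real"
    where Yd: "Y \<in> borel_measurable M \<and> (\<forall>\<omega>. 0 \<le> Y \<omega> \<and> Y \<omega> \<le> 1) \<and>
      (\<forall>i. d i \<in> borel_measurable borel) \<and> (\<forall>i \<omega>. d i (Y \<omega>) = X i \<omega>)"
    using real_code_of_sequence[where X=X, OF XM] by (elim exE) (rule that)
  then have Y: "Y \<in> borel_measurable M" and Y01: "\<And>\<omega>. 0 \<le> Y \<omega> \<and> Y \<omega> \<le> 1"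
    and d: "\<And>i. d i \<in> borel_measurable borel" and dY: "\<And>i \<omega>. d i (Y \<omega>) = X i \<omega>"
    by blast+
  have sub: "subalgebra M (natural_algebra M Z {0..})" by (rule subalgebra_natural) auto
  obtain Y' :: "'w \<times> real \<Rightarrow> real" where Y': "Y' \<in> borel_measurable (natural_algebra M Z {0..} \<Otimes>\<^sub>M borel)"
    and same: "distr (M \<Otimes>\<^sub>M uniform01) (natural_algebra M Z {0..} \<Otimes>\<^sub>M borel) (\<lambda>w. (fst w, Y' w))
      = distr M (natural_algebra M Z {0..} \<Otimes>\<^sub>M borel) (\<lambda>\<omega>. (\<omega>, Y \<omega>))"
    using conditional_copy[OF sub Y Y01] by blast
  interpret copied_variable M F Z Y Y'
    by (intro copied_variable.intro copied_variable_axioms.intro levy_process_axioms Y Y' same)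
  define D where "D = grid_lim d"
  have Dm: "D t \<in> borel_measurable borel" for t
    unfolding D_def grid_lim_def[abs_def] using d by measurable
  have DF: "(\<lambda>\<omega>. D t (Y \<omega>)) \<in> borel_measurable (F t)" if t: "0 \<le> t" for t
    unfolding D_def grid_lim_def dY by (intro borel_measurable_lim_metric XF grid_bounds t)
  have dX: "d (n, k) (Y \<omega>) = \<xi> (real k / real (Suc n)) \<omega> - x - Z (real k / real (Suc n)) \<omega>" for n k \<omega>
    unfolding dY by (simp add: X_def)
  have on_path: "\<xi> t \<omega> = x + D t (Y \<omega>) + Z t \<omega>" "drift_path a x d (\<lambda>s. Z s \<omega>) (Y \<omega>)"
    if "solves_path a x (\<lambda>t. Z t \<omega>) (\<lambda>t. \<xi> t \<omega>)" "0 \<le> t" for t \<omega>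
    using solves_path_imp_drift_path[where f="\<lambda>t. \<xi> t \<omega>" and z="\<lambda>t. Z t \<omega>" and d=d and y="Y \<omega>",
        OF that(1) dX] that(2) by (simp_all add: D_def)
  have orig: "AE \<omega> in M. \<xi> t \<omega> = x + D t (Y \<omega>) + Z t \<omega>" if t: "0 \<le> t" for t
    using solves by eventually_elim (rule on_path(1)[OF _ t])
  have "AE \<omega> in M. drift_path a x d (\<lambda>s. Z s (fst (\<omega>, Y \<omega>))) (snd (\<omega>, Y \<omega>))"
    using solves by eventually_elim (use on_path(2)[of _ 0] in simp)
  from AE_copy[OF pred_drift_path[OF a d] this]
  have copy: "AE w in N. drift_path a x d (\<lambda>s. Z s (fst w)) (Y' w)" by simp
  define Z' where "Z' = (\<lambda>t (w :: 'w \<times> real). Z t (fst w))"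
  have levy': "levy_process N H Z'" unfolding Z'_def by (rule levy_process_copy)
  have law': "process_law N Z' = L"
    using process_law_distr[OF fst_measurable distr_fst measurable_Z] law by (simp add: Z'_def)
  have sol1: "weak_solution a x L N H Z' (\<lambda>t w. \<xi> t (fst w))"
    unfolding weak_solution_def sde_solution_iff_solves_path
    using levy' law' measurable_fst_H[OF _ \<xi>F] AE_fst[OF solves] by (simp add: adapted_def Z'_def)
  have sol2: "weak_solution a x L N H Z' (\<lambda>t w. x + D t (Y' w) + Z t (fst w))"
    unfolding weak_solution_def sde_solution_iff_solves_path
  proof (intro conjI levy' law')
    show "adapted H (\<lambda>t w. x + D t (Y' w) + Z t (fst w))"
      unfolding adapted_def
      by (intro allI impI borel_measurable_add borel_measurable_const measurable_copy_H[OF _ Dm DF]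
          measurable_fst_H[OF _ measurable_Z_F]) auto
    show "AE w in N. solves_path a x (\<lambda>t. Z' t w) (\<lambda>t. x + D t (Y' w) + Z t (fst w))"
      using copy by eventually_elim (simp add: Z'_def D_def drift_path_imp_solves_path)
  qed
  have DC: "(\<lambda>\<omega>. D t (Y \<omega>)) \<in> borel_measurable (completed_natural_filtration M Z t)" if t: "0 \<le> t" for t
  proof (rule measurableI)
    fix S :: "real set" assume S: "S \<in> sets borel"
    define B where "B = D t -` S"
    define A where "A = Y -` B \<inter> space M"
    have B: "B \<in> sets borel" using measurable_sets[OF Dm S] by (simp add: B_def)
    have A: "A \<in> sets (F t)"
      using measurable_sets[OF DF[OF t] S] space_F[OF t] by (simp add: A_def B_def vimage_def)
    then have AM: "A \<in> events" using sets_F[OF t] by auto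
    obtain f where f: "f \<in> borel_measurable (natural_algebra M Z {0..t})" "integrable M f"
      and prob: "\<And>C. C \<in> events \<Longrightarrow> N.prob {w\<in>space N. fst w \<in> C \<and> Y' w \<in> B} = (LINT \<omega>:C|M. f \<omega>)"
      using copy_conditional_prob[OF t B A[unfolded A_def]] by blast
    have "AE w in N. \<xi> t (fst w) = x + D t (Y' w) + Z t (fst w)"
      by (rule pathwise_uniqueness[OF uniq sol1 sol2 t])
    with AE_fst[OF orig[OF t]] AE_space
    have ae: "AE w in N. Y' w \<in> B \<longleftrightarrow> fst w \<in> A"
      by eventually_elim (auto simp: A_def B_def space_N)
    \<comment> \<open>Both sides have the same integral over every event C: the probability that C occurs and Y' is in B.\<close>
    have "AE \<omega> in M. f \<omega> = indicator A \<omega>"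
    proof (rule AE_eq_if_same_set_integrals[where G=M])
      show "subalgebra M M" by (simp add: subalgebra_def)
      show "f \<in> borel_measurable M" "integrable M f" using f(2) by auto
      show "indicator A \<in> borel_measurable M" "integrable M (indicator A :: 'w \<Rightarrow> real)"
        using AM by (auto simp: less_top[symmetric])
      fix C assume C: "C \<in> events"
      have "(LINT \<omega>:C|M. f \<omega>) = N.prob {w\<in>space N. fst w \<in> C \<and> Y' w \<in> B}" using prob[OF C] by simp
      also have "\<dots> = N.prob (fst -` (C \<inter> A) \<inter> space N)"
        using ae event_measurable[OF C B] measurable_sets[OF fst_measurable sets.Int[OF C AM]]
        by (intro N.finite_measure_eq_AE) auto
      also have "\<dots> = measure (distr N M fst) (C \<inter> A)"
        using C AM by (intro measure_distr[OF fst_measurable, symmetric]) auto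
      also have "\<dots> = (LINT \<omega>|M. indicator (C \<inter> A) \<omega>)" using C AM by (simp add: distr_fst)
      also have "\<dots> = (LINT \<omega>:C|M. indicator A \<omega>)"
        unfolding set_lebesgue_integral_def by (simp add: indicator_inter_arith)
      finally show "(LINT \<omega>:C|M. f \<omega>) = (LINT \<omega>:C|M. indicator A \<omega>)" .
    qed
    then have ae: "AE \<omega> in M. \<omega> \<in> f -` {1} \<inter> space M \<longleftrightarrow> \<omega> \<in> A"
      using AE_space by eventually_elim (auto simp: A_def indicator_def)
    have "f -` {1} \<inter> space M \<in> sets (completed_natural_filtration M Z t)"
      using measurable_sets[OF f(1), of "{1}"] natural_subset_completed[of M Z t] by auto
    from completed_natural_filtration_AE_eq[OF this _ ae]
    have "A \<in> sets (completed_natural_filtration M Z t)" by (simp add: A_def)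
    then show "(\<lambda>\<omega>. D t (Y \<omega>)) -` S \<inter> space (completed_natural_filtration M Z t)
      \<in> sets (completed_natural_filtration M Z t)"
      by (simp add: A_def B_def vimage_def)
  qed simp
  have "adapted (completed_natural_filtration M Z) \<xi>"
    unfolding adapted_def
  proof (intro allI impI)
    fix t :: real assume t: "0 \<le> t"
    let ?C = "completed_natural_filtration M Z t"
    have "Z t \<in> borel_measurable ?C"
      using t natural_subset_completed[of M Z t]
      by (intro measurable_from_subalg[OF _ measurable_natural_algebra[of t "{0..t}" Z M]]) (auto simp: subalgebra_def)
    then have g: "(\<lambda>\<omega>. x + D t (Y \<omega>) + Z t \<omega>) \<in> borel_measurable ?C" using DC[OF t] by measurable
    show "\<xi> t \<in> borel_measurable ?C"
    proof (rule measurableI)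
      fix S :: "real set" assume S: "S \<in> sets borel"
      have B: "(\<lambda>\<omega>. x + D t (Y \<omega>) + Z t \<omega>) -` S \<inter> space M \<in> sets ?C"
        using measurable_sets[OF g S] by simp
      have ae: "AE \<omega> in M. \<omega> \<in> (\<lambda>\<omega>. x + D t (Y \<omega>) + Z t \<omega>) -` S \<inter> space M \<longleftrightarrow> \<omega> \<in> \<xi> t -` S \<inter> space M"
        using orig[OF t] by eventually_elim simp
      show "\<xi> t -` S \<inter> space ?C \<in> sets ?C"
        using completed_natural_filtration_AE_eq[OF B _ ae] by simp
    qed simp
  qed
  then show ?thesis using ws by (simp add: strong_solution_def weak_solution_def)
qed

theorem corollary1p2:
  fixes a :: "real \<Rightarrow> real" and x :: real
    and M\<^sub>0 :: "'v measure" and F\<^sub>0 :: "real \<Rightarrow> 'v measure" and Z\<^sub>0 :: "real \<Rightarrow> 'v \<Rightarrow> real"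
    and M :: "'w measure" and F :: "real \<Rightarrow> 'w measure" and Z \<xi> :: "real \<Rightarrow> 'w \<Rightarrow> real"
  assumes "a \<in> borel_measurable borel"
    and "levy_process M\<^sub>0 F\<^sub>0 Z\<^sub>0"
    and "weak_solution_exists a x (process_law M\<^sub>0 Z\<^sub>0)"
    and "weak_solution_unique a x (process_law M\<^sub>0 Z\<^sub>0)"
    and "weak_solution a x (process_law M\<^sub>0 Z\<^sub>0) M F Z \<xi>"
  shows "strong_solution a x M F Z \<xi>"
  using assms(1,4,5) by (rule weak_uniqueness_implies_strong_solution)

end
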